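(* Let $D:\mathcal{U}$, $R:D\to D\to\mathcal{U}$, and $\mathsf{quot}\,D\,R$, $\mathsf{cls}$, $\mathsf{rec}_{\mathsf q}$ as in the context. Let $C:\mathcal{U}$, $g:D\to C$, $H:\mathsf{EqCls}\,g\,R$, and $f:\mathsf{quot}\,D\,R\to C$. If $f\circ\mathsf{cls} = g$, then $f = \mathsf{rec}_{\mathsf q}\,C\,g\,H$.
   Context: Type theory: intensional Martin-Löf type theory with universes $\mathcal{U}:\mathcal{U}_0:\cdots$, bottom universe $\mathcal{U}$ impredicative (if $A$ is a type in any universe and $a:A\vdash B:\mathcal{U}$ then $\prod_{a:A}B:\mathcal{U}$), universes closed under $\Sigma$ and identity types; $\pi_1,\pi_2$ projections, $f\circ g := \lambda x.f(g\,x)$. Axioms: function extensionality and UIP. For $f:D\to C$: $\mathsf{EqCls}\,f\,R := \prod_{x,y:D} R\,x\,y\to f\,x=f\,y$. $\mathsf{quot}^*\,D\,R := \prod_{C:\mathcal{U}}\prod_{f:D\to C}\mathsf{EqCls}\,f\,R\to C$; $\mathsf{cls}^*\,d := \lambda C\,f\,H.\ f\,d$; $\mathsf{rec}^*\,C\,f\,H\,q := q\,C\,f\,H$. $\mathsf{LimQuot}\,q := \prod_{X,Y:\mathcal{U}}\prod_{g:D\to X}\prod_{g':D\to Y}\prod_{f:X\to Y}\prod_{H:\mathsf{EqCls}\,g\,R}\prod_{H':\mathsf{EqCls}\,g'\,R} (f\circ g = g') \to f(\mathsf{rec}^*\,X\,g\,H\,q) = \mathsf{rec}^*\,Y\,g'\,H'\,q$.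 $\mathsf{quot}\,D\,R := \sum_{q:\mathsf{quot}^*\,D\,R}\mathsf{LimQuot}\,q$. With a proof $p:\prod_{d}\mathsf{LimQuot}(\mathsf{cls}^*\,d)$ (which exists), $\mathsf{cls}\,d := \langle \mathsf{cls}^*\,d, p\,d\rangle$. $\mathsf{rec}_{\mathsf q}\,C\,f\,H\,q := \mathsf{rec}^*\,C\,f\,H\,(\pi_1 q)$. *)

theory Defs
  imports Main
begin

text \<open>
  Intensional Martin-Loef type theory with an impredicative bottom universe, as a deep embedding
  with de Bruijn indices. In \<open>Pi A B\<close> and \<open>Sg A B\<close> the family \<open>B\<close> binds one variable;
  \<open>Lam A b\<close> binds one variable in \<open>b\<close>; in \<open>Split P b t\<close> the motive \<open>P\<close> binds one
  variable and \<open>b\<close> binds two; in \<open>J P d p\<close> the motive \<open>P\<close> binds two (the free endpoint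
  and the path). \<open>Univ 0\<close> is the impredicative universe, \<open>Univ (Suc i)\<close> is the \<open>i\<close>-th
  universe above it. \<open>Eq A a b\<close> is the identity type, and \<open>Tuple A B a b\<close> is the pair
  of \<open>a\<close> and \<open>b\<close> in \<open>Sg A B\<close>. \<open>Funext f g h\<close> and \<open>Uip p q\<close> are the proof constants of the two axioms.
\<close>

datatype trm =
    Var nat
  | Univ nat
  | Pi trm trm
  | Lam trm trm
  | App trm trm  (infixl \<open>\<cdot>\<close> 200)
  | Sg trm trm
  | Tuple trm trm trm trm
  | Split trm trm trm
  | Eq trm trm trm
  | Refl trm trm
  | J trm trm trm
  | Funext trm trm trm
  | Uip trm trm

definition upr :: "(nat \<Rightarrow> nat) \<Rightarrow> nat \<Rightarrow> nat" where
  "upr \<xi> = case_nat 0 (\<lambda>n. Suc (\<xi> n))"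

primrec rename :: "(nat \<Rightarrow> nat) \<Rightarrow> trm \<Rightarrow> trm" where
  "rename \<xi> (Var n) = Var (\<xi> n)"
| "rename \<xi> (Univ i) = Univ i"
| "rename \<xi> (Pi A B) = Pi (rename \<xi> A) (rename (upr \<xi>) B)"
| "rename \<xi> (Lam A b) = Lam (rename \<xi> A) (rename (upr \<xi>) b)"
| "rename \<xi> (App f a) = App (rename \<xi> f) (rename \<xi> a)"
| "rename \<xi> (Sg A B) = Sg (rename \<xi> A) (rename (upr \<xi>) B)"
| "rename \<xi> (Tuple A B a b) = Tuple (rename \<xi> A) (rename (upr \<xi>) B) (rename \<xi> a) (rename \<xi> b)"
| "rename \<xi> (Split P b t) = Split (rename (upr \<xi>) P) (rename (upr (upr \<xi>)) b) (rename \<xi> t)"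
| "rename \<xi> (Eq A a b) = Eq (rename \<xi> A) (rename \<xi> a) (rename \<xi> b)"
| "rename \<xi> (Refl A a) = Refl (rename \<xi> A) (rename \<xi> a)"
| "rename \<xi> (J P d p) = J (rename (upr (upr \<xi>)) P) (rename \<xi> d) (rename \<xi> p)"
| "rename \<xi> (Funext f g h) = Funext (rename \<xi> f) (rename \<xi> g) (rename \<xi> h)"
| "rename \<xi> (Uip p q) = Uip (rename \<xi> p) (rename \<xi> q)"

definition lift :: "nat \<Rightarrow> trm \<Rightarrow> trm" where
  "lift k = rename (\<lambda>n. n + k)"

definition ups :: "(nat \<Rightarrow> trm) \<Rightarrow> nat \<Rightarrow> trm" where
  "ups \<sigma> = case_nat (Var 0) (\<lambda>n. lift 1 (\<sigma> n))"

primrec subst :: "(nat \<Rightarrow> trm) \<Rightarrow> trm \<Rightarrow> trm" where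
  "subst \<sigma> (Var n) = \<sigma> n"
| "subst \<sigma> (Univ i) = Univ i"
| "subst \<sigma> (Pi A B) = Pi (subst \<sigma> A) (subst (ups \<sigma>) B)"
| "subst \<sigma> (Lam A b) = Lam (subst \<sigma> A) (subst (ups \<sigma>) b)"
| "subst \<sigma> (App f a) = App (subst \<sigma> f) (subst \<sigma> a)"
| "subst \<sigma> (Sg A B) = Sg (subst \<sigma> A) (subst (ups \<sigma>) B)"
| "subst \<sigma> (Tuple A B a b) = Tuple (subst \<sigma> A) (subst (ups \<sigma>) B) (subst \<sigma> a) (subst \<sigma> b)"
| "subst \<sigma> (Split P b t) = Split (subst (ups \<sigma>) P) (subst (ups (ups \<sigma>)) b) (subst \<sigma> t)"
| "subst \<sigma> (Eq A a b) = Eq (subst \<sigma> A) (subst \<sigma> a) (subst \<sigma> b)"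
| "subst \<sigma> (Refl A a) = Refl (subst \<sigma> A) (subst \<sigma> a)"
| "subst \<sigma> (J P d p) = J (subst (ups (ups \<sigma>)) P) (subst \<sigma> d) (subst \<sigma> p)"
| "subst \<sigma> (Funext f g h) = Funext (subst \<sigma> f) (subst \<sigma> g) (subst \<sigma> h)"
| "subst \<sigma> (Uip p q) = Uip (subst \<sigma> p) (subst \<sigma> q)"

definition inst1 :: "trm \<Rightarrow> trm \<Rightarrow> trm" where
  "inst1 t a = subst (case_nat a Var) t"

text \<open>\<open>inst2 t a b\<close> replaces index 1 by \<open>a\<close> and index 0 by \<open>b\<close>, both in the outer scope.\<close>

definition inst2 :: "trm \<Rightarrow> trm \<Rightarrow> trm \<Rightarrow> trm" where
  "inst2 t a b = subst (case_nat b (case_nat a Var)) t"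

text \<open>
  Judgmental equality: the congruence generated by the computation rules of \<open>\<Pi>\<close>, \<open>\<Sigma>\<close> and
  identity types, on raw terms as in pure type systems. There are no judgmental uniqueness
  (\<open>\<eta>\<close>) rules, so what is derivable here is also derivable with them, and the two
  axioms do not compute.
\<close>

inductive conv :: "trm \<Rightarrow> trm \<Rightarrow> bool"  (infix \<open>\<simeq>\<close> 50) where
  conv_refl: "t \<simeq> t"
| conv_sym: "s \<simeq> t \<Longrightarrow> t \<simeq> s"
| conv_trans: "s \<simeq> t \<Longrightarrow> t \<simeq> u \<Longrightarrow> s \<simeq> u"
| beta_App: "Lam A b \<cdot> a \<simeq> inst1 b a"
| beta_Split: "Split P b (Tuple A B x y) \<simeq> inst2 b x y"
| beta_J: "J P d (Refl A a) \<simeq> d"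
| cong_Pi: "A \<simeq> A' \<Longrightarrow> B \<simeq> B' \<Longrightarrow> Pi A B \<simeq> Pi A' B'"
| cong_Lam: "A \<simeq> A' \<Longrightarrow> b \<simeq> b' \<Longrightarrow> Lam A b \<simeq> Lam A' b'"
| cong_App: "f \<simeq> f' \<Longrightarrow> a \<simeq> a' \<Longrightarrow> f \<cdot> a \<simeq> f' \<cdot> a'"
| cong_Sg: "A \<simeq> A' \<Longrightarrow> B \<simeq> B' \<Longrightarrow> Sg A B \<simeq> Sg A' B'"
| cong_Tuple: "A \<simeq> A' \<Longrightarrow> B \<simeq> B' \<Longrightarrow> x \<simeq> x' \<Longrightarrow> y \<simeq> y' \<Longrightarrow> Tuple A B x y \<simeq> Tuple A' B' x' y'"
| cong_Split: "P \<simeq> P' \<Longrightarrow> b \<simeq> b' \<Longrightarrow> t \<simeq> t' \<Longrightarrow> Split P b t \<simeq> Split P' b' t'"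
| cong_Eq: "A \<simeq> A' \<Longrightarrow> a \<simeq> a' \<Longrightarrow> b \<simeq> b' \<Longrightarrow> Eq A a b \<simeq> Eq A' a' b'"
| cong_Refl: "A \<simeq> A' \<Longrightarrow> a \<simeq> a' \<Longrightarrow> Refl A a \<simeq> Refl A' a'"
| cong_J: "P \<simeq> P' \<Longrightarrow> d \<simeq> d' \<Longrightarrow> p \<simeq> p' \<Longrightarrow> J P d p \<simeq> J P' d' p'"
| cong_Funext: "f \<simeq> f' \<Longrightarrow> g \<simeq> g' \<Longrightarrow> h \<simeq> h' \<Longrightarrow> Funext f g h \<simeq> Funext f' g' h'"
| cong_Uip: "p \<simeq> p' \<Longrightarrow> q \<simeq> q' \<Longrightarrow> Uip p q \<simeq> Uip p' q'"

text \<open>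
  Contexts are lists with the most recent declaration first. Universes are Russell-style and not
  cumulative; \<open>ty_Pi_impred\<close> is the impredicativity of \<open>Univ 0\<close>.
\<close>

inductive wf_ctx :: "trm list \<Rightarrow> bool"  (\<open>\<turnstile> _ ctx\<close> [51] 50)
  and typing :: "trm list \<Rightarrow> trm \<Rightarrow> trm \<Rightarrow> bool"  (\<open>_ \<turnstile> _ \<Colon> _\<close> [51, 51, 51] 50) where
  wf_Nil: "\<turnstile> [] ctx"
| wf_Cons: "\<turnstile> \<Gamma> ctx \<Longrightarrow> \<Gamma> \<turnstile> A \<Colon> Univ i \<Longrightarrow> \<turnstile> A # \<Gamma> ctx"
| ty_Var: "\<turnstile> \<Gamma> ctx \<Longrightarrow> n < length \<Gamma> \<Longrightarrow> \<Gamma> \<turnstile> Var n \<Colon> lift (Suc n) (\<Gamma> ! n)"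
| ty_Univ: "\<turnstile> \<Gamma> ctx \<Longrightarrow> \<Gamma> \<turnstile> Univ i \<Colon> Univ (Suc i)"
| ty_conv: "\<Gamma> \<turnstile> t \<Colon> A \<Longrightarrow> A \<simeq> B \<Longrightarrow> \<Gamma> \<turnstile> B \<Colon> Univ i \<Longrightarrow> \<Gamma> \<turnstile> t \<Colon> B"
| ty_Pi: "\<Gamma> \<turnstile> A \<Colon> Univ i \<Longrightarrow> A # \<Gamma> \<turnstile> B \<Colon> Univ (Suc j) \<Longrightarrow> \<Gamma> \<turnstile> Pi A B \<Colon> Univ (max i (Suc j))"
| ty_Pi_impred: "\<Gamma> \<turnstile> A \<Colon> Univ i \<Longrightarrow> A # \<Gamma> \<turnstile> B \<Colon> Univ 0 \<Longrightarrow> \<Gamma> \<turnstile> Pi A B \<Colon> Univ 0"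
| ty_Lam: "\<Gamma> \<turnstile> Pi A B \<Colon> Univ i \<Longrightarrow> A # \<Gamma> \<turnstile> b \<Colon> B \<Longrightarrow> \<Gamma> \<turnstile> Lam A b \<Colon> Pi A B"
| ty_App: "\<Gamma> \<turnstile> f \<Colon> Pi A B \<Longrightarrow> \<Gamma> \<turnstile> a \<Colon> A \<Longrightarrow> \<Gamma> \<turnstile> f \<cdot> a \<Colon> inst1 B a"
| ty_Sg: "\<Gamma> \<turnstile> A \<Colon> Univ i \<Longrightarrow> A # \<Gamma> \<turnstile> B \<Colon> Univ j \<Longrightarrow> \<Gamma> \<turnstile> Sg A B \<Colon> Univ (max i j)"
| ty_Tuple: "\<Gamma> \<turnstile> Sg A B \<Colon> Univ i \<Longrightarrow> \<Gamma> \<turnstile> a \<Colon> A \<Longrightarrow> \<Gamma> \<turnstile> b \<Colon> inst1 B a \<Longrightarrow>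
    \<Gamma> \<turnstile> Tuple A B a b \<Colon> Sg A B"
| ty_Split: "\<Gamma> \<turnstile> t \<Colon> Sg A B \<Longrightarrow> Sg A B # \<Gamma> \<turnstile> P \<Colon> Univ i \<Longrightarrow>
    B # A # \<Gamma> \<turnstile> b \<Colon> subst (case_nat
      (Tuple (lift 2 A) (rename (upr (\<lambda>n. n + 2)) B) (Var 1) (Var 0)) (\<lambda>n. Var (n + 2))) P \<Longrightarrow>
    \<Gamma> \<turnstile> Split P b t \<Colon> inst1 P t"
| ty_Eq: "\<Gamma> \<turnstile> A \<Colon> Univ i \<Longrightarrow> \<Gamma> \<turnstile> a \<Colon> A \<Longrightarrow> \<Gamma> \<turnstile> b \<Colon> A \<Longrightarrow> \<Gamma> \<turnstile> Eq A a b \<Colon> Univ i"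
| ty_Refl: "\<Gamma> \<turnstile> a \<Colon> A \<Longrightarrow> \<Gamma> \<turnstile> Refl A a \<Colon> Eq A a a"
| ty_J: "\<Gamma> \<turnstile> p \<Colon> Eq A a b \<Longrightarrow> Eq (lift 1 A) (lift 1 a) (Var 0) # A # \<Gamma> \<turnstile> P \<Colon> Univ i \<Longrightarrow>
    \<Gamma> \<turnstile> d \<Colon> inst2 P a (Refl A a) \<Longrightarrow> \<Gamma> \<turnstile> J P d p \<Colon> inst2 P b p"
| ty_Funext: "\<Gamma> \<turnstile> f \<Colon> Pi A B \<Longrightarrow> \<Gamma> \<turnstile> g \<Colon> Pi A B \<Longrightarrow>
    \<Gamma> \<turnstile> h \<Colon> Pi A (Eq B (lift 1 f \<cdot> Var 0) (lift 1 g \<cdot> Var 0)) \<Longrightarrow>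
    \<Gamma> \<turnstile> Funext f g h \<Colon> Eq (Pi A B) f g"
| ty_Uip: "\<Gamma> \<turnstile> p \<Colon> Eq A a b \<Longrightarrow> \<Gamma> \<turnstile> q \<Colon> Eq A a b \<Longrightarrow> \<Gamma> \<turnstile> Uip p q \<Colon> Eq (Eq A a b) p q"

abbreviation \<U> :: trm where
  "\<U> \<equiv> Univ 0"

definition Arr :: "trm \<Rightarrow> trm \<Rightarrow> trm"  (infixr \<open>\<rightarrow>\<close> 190) where
  "A \<rightarrow> B = Pi A (lift 1 B)"

text \<open>\<open>compose D f g\<close> is the composite \<open>f \<circ> g\<close> of \<open>g\<close> with domain \<open>D\<close> and \<open>f\<close>.\<close>

definition compose :: "trm \<Rightarrow> trm \<Rightarrow> trm \<Rightarrow> trm" where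
  "compose D f g = Lam D (lift 1 f \<cdot> (lift 1 g \<cdot> Var 0))"

text \<open>First projection, for the first component type \<open>A\<close>.\<close>

definition proj1 :: "trm \<Rightarrow> trm \<Rightarrow> trm" where
  "proj1 A t = Split (lift 1 A) (Var 1) t"

definition EqCls :: "trm \<Rightarrow> trm \<Rightarrow> trm \<Rightarrow> trm \<Rightarrow> trm" where
  "EqCls D R C f =
    Pi D (Pi (lift 1 D)
      (lift 2 R \<cdot> Var 1 \<cdot> Var 0 \<rightarrow> Eq (lift 2 C) (lift 2 f \<cdot> Var 1) (lift 2 f \<cdot> Var 0)))"

definition quot_star :: "trm \<Rightarrow> trm \<Rightarrow> trm" where
  "quot_star D R =
    Pi \<U> (Pi (lift 1 D \<rightarrow> Var 0) (EqCls (lift 2 D) (lift 2 R) (Var 1) (Var 0) \<rightarrow> Var 1))"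

definition cls_star :: "trm \<Rightarrow> trm \<Rightarrow> trm \<Rightarrow> trm" where
  "cls_star D R d =
    Lam \<U> (Lam (lift 1 D \<rightarrow> Var 0)
      (Lam (EqCls (lift 2 D) (lift 2 R) (Var 1) (Var 0)) (Var 1 \<cdot> lift 3 d)))"

definition rec_star :: "trm \<Rightarrow> trm \<Rightarrow> trm \<Rightarrow> trm \<Rightarrow> trm" where
  "rec_star C f H q = q \<cdot> C \<cdot> f \<cdot> H"

text \<open>
  The variables bound below are, in order, \<open>X\<close>, \<open>Y\<close>, \<open>g : D \<rightarrow> X\<close>, \<open>g' : D \<rightarrow> Y\<close>,
  \<open>f : X \<rightarrow> Y\<close>, \<open>H : EqCls g\<close> and \<open>H' : EqCls g'\<close>; in the last two lines they have the
  indices 6, 5, 4, 3, 2, 1 and 0.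
\<close>

definition LimQuot :: "trm \<Rightarrow> trm \<Rightarrow> trm \<Rightarrow> trm" where
  "LimQuot D R q =
    Pi \<U> (Pi \<U> (Pi (lift 2 D \<rightarrow> Var 1) (Pi (lift 3 D \<rightarrow> Var 1) (Pi (Var 3 \<rightarrow> Var 2)
      (Pi (EqCls (lift 5 D) (lift 5 R) (Var 4) (Var 2))
      (Pi (EqCls (lift 6 D) (lift 6 R) (Var 4) (Var 2))
        (Eq (lift 7 D \<rightarrow> Var 5) (compose (lift 7 D) (Var 2) (Var 4)) (Var 3) \<rightarrow>
         Eq (Var 5) (Var 2 \<cdot> rec_star (Var 6) (Var 4) (Var 1) (lift 7 q))
                    (rec_star (Var 5) (Var 3) (Var 0) (lift 7 q)))))))))"

definition quot :: "trm \<Rightarrow> trm \<Rightarrow> trm" where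
  "quot D R = Sg (quot_star D R) (LimQuot (lift 1 D) (lift 1 R) (Var 0))"

text \<open>The type of the proofs that every \<open>cls_star d\<close> satisfies the limit condition.\<close>

definition LimCls :: "trm \<Rightarrow> trm \<Rightarrow> trm" where
  "LimCls D R = Pi D (LimQuot (lift 1 D) (lift 1 R) (cls_star (lift 1 D) (lift 1 R) (Var 0)))"

text \<open>
  \<open>cls D R p\<close> is the class map as a function on \<open>D\<close>, for \<open>p\<close> of type \<open>LimCls D R\<close>, and
  \<open>rec_q D R C f H\<close> is the recursor as a function on \<open>quot D R\<close>.
\<close>

definition cls :: "trm \<Rightarrow> trm \<Rightarrow> trm \<Rightarrow> trm" where
  "cls D R p =
    Lam D (Tuple (lift 1 (quot_star D R)) (LimQuot (lift 2 D) (lift 2 R) (Var 0))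
      (cls_star (lift 1 D) (lift 1 R) (Var 0)) (lift 1 p \<cdot> Var 0))"

definition rec_q :: "trm \<Rightarrow> trm \<Rightarrow> trm \<Rightarrow> trm \<Rightarrow> trm \<Rightarrow> trm" where
  "rec_q D R C f H =
    Lam (quot D R)
      (rec_star (lift 1 C) (lift 1 f) (lift 1 H) (proj1 (lift 1 (quot_star D R)) (Var 0)))"

end

(*
  Apply the limit condition of a pair <q, l> with X = quot D R, Y = C and the maps cls, g, f:
  it gives f (rec* cls q) = rec* g q, so it remains to see that rec* cls q = <q, l>. As LimQuot
  is a proposition (function extensionality and UIP), this only concerns first projections, and
  by function extensionality these may be compared at arguments C', f', H'. There the equation
  is the limit condition of <q, l> once more, now for the map rec_q C' f' H' from quot D R to C'.

  The object theory is used through the predicate inh ("the type is inhabited"), so that no proof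
  terms have to be written down; the only metatheorem needed is closure of typing under renaming.
*)

theory Submission
  imports Defs
begin

subsection \<open>Renaming and substitution\<close>

text \<open>Impredicativity puts \<open>quot D R\<close> back into \<open>\<U>\<close>, which is why
  the quotient itself may serve as one of the two target types in the limit condition. For this,
  \<open>cls\<close> has to respect \<open>R\<close>, and that already rests on
  \<open>LimQuot\<close> being a proposition: the classes of two related elements carry different
  proof components.

  Two features of the object theory shape the lemmas. First, as only renaming of typing derivations
  is established, an instance of a statement is obtained by abstracting over a variable and applying
  the resulting function, so that the rule for application performs the substitution; for the same
  reason the lemmas take as hypotheses that the types they mention are well formed. Second,
  conversion has no eta rules: functions are compared after application to a fresh variable, and a
  claim about an arbitrary element of the quotient is reduced to pairs by
  \<open>Split\<close>.\<close>

lemma upr_simps [simp]: "upr \<xi> 0 = 0" "upr \<xi> (Suc n) = Suc (\<xi> n)"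
  by (simp_all add: upr_def)

lemma ups_simps [simp]: "ups \<sigma> 0 = Var 0" "ups \<sigma> (Suc n) = rename Suc (\<sigma> n)"
  by (simp_all add: ups_def lift_def)

lemma ups_Var [simp]: "ups Var = Var"
  by (rule ext, case_tac x) auto

lemma subst_Var [simp]: "subst Var t = t"
  by (induction t) auto

lemma ups_comp_Var: "ups (\<lambda>n. Var (\<xi> n)) = (\<lambda>n. Var (upr \<xi> n))"
  by (rule ext, case_tac n) auto

text \<open>Viewing a renaming as a substitution by variables lets the single fusion law
  \<open>subst_subst\<close> settle identities that mix \<open>lift\<close>, \<open>inst1\<close>
  and \<open>subst\<close>.\<close>

lemma rename_eq_subst: "rename \<xi> t = subst (\<lambda>n. Var (\<xi> n)) t"
  by (induction t arbitrary: \<xi>) (auto simp: ups_comp_Var)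

lemma rename_cong: "(\<And>n. \<xi> n = \<zeta> n) \<Longrightarrow> rename \<xi> t = rename \<zeta> t"
  by metis

lemma ups_upr: "(\<lambda>n. ups \<sigma> (upr \<xi> n)) = ups (\<lambda>n. \<sigma> (\<xi> n))"
  by (rule ext, case_tac n) auto

lemma subst_rename: "subst \<sigma> (rename \<xi> t) = subst (\<lambda>n. \<sigma> (\<xi> n)) t"
  by (induction t arbitrary: \<sigma> \<xi>) (auto simp: ups_upr)

lemma rename_rename: "rename \<xi> (rename \<zeta> t) = rename (\<lambda>n. \<xi> (\<zeta> n)) t"
  by (simp add: rename_eq_subst[of \<xi>] rename_eq_subst[of "\<lambda>n. \<xi> (\<zeta> n)"] subst_rename)

lemma upr_ups: "(\<lambda>n. rename (upr \<xi>) (ups \<sigma> n)) = ups (\<lambda>n. rename \<xi> (\<sigma> n))"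
  by (rule ext, case_tac n) (auto simp: rename_rename)

lemma rename_subst: "rename \<xi> (subst \<sigma> t) = subst (\<lambda>n. rename \<xi> (\<sigma> n)) t"
  by (induction t arbitrary: \<sigma> \<xi>) (auto simp: upr_ups)

lemma ups_ups: "(\<lambda>n. subst (ups \<sigma>) (ups \<tau> n)) = ups (\<lambda>n. subst \<sigma> (\<tau> n))"
  by (rule ext, case_tac n) (auto simp: rename_subst subst_rename)

lemma subst_subst: "subst \<sigma> (subst \<tau> t) = subst (\<lambda>n. subst \<sigma> (\<tau> n)) t"
  by (induction t arbitrary: \<sigma> \<tau>) (auto simp: ups_ups)

lemma subst_cong: "(\<And>n. \<sigma> n = \<tau> n) \<Longrightarrow> subst \<sigma> t = subst \<tau> t"
  by metis

lemma rename_inst1: "rename \<xi> (inst1 t a) = inst1 (rename (upr \<xi>) t) (rename \<xi> a)"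
  unfolding inst1_def rename_subst subst_rename by (rule subst_cong) (simp split: nat.split)

lemma rename_inst2: "rename \<xi> (inst2 t a b) = inst2 (rename (upr (upr \<xi>)) t) (rename \<xi> a) (rename \<xi> b)"
  unfolding inst2_def rename_subst subst_rename by (rule subst_cong) (simp add: upr_def split: nat.split)

text \<open>The branch type in \<open>ty_Split\<close> is the motive at the generic pair of the two
  bound variables. Renaming through both binders must produce the same instance of the renamed
  motive, or the rule could not be applied again after renaming.\<close>

lemma rename_Split_branch:
  "rename (upr (upr \<xi>)) (subst (case_nat
      (Tuple (lift 2 A) (rename (upr (\<lambda>n. n + 2)) B) (Var 1) (Var 0)) (\<lambda>n. Var (n + 2))) P)
    = subst (case_nat (Tuple (lift 2 (rename \<xi> A)) (rename (upr (\<lambda>n. n + 2)) (rename (upr \<xi>) B))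
      (Var 1) (Var 0)) (\<lambda>n. Var (n + 2))) (rename (upr \<xi>) P)"
  unfolding rename_subst subst_rename
proof (rule subst_cong)
  fix n
  show "rename (upr (upr \<xi>)) (case_nat
        (Tuple (lift 2 A) (rename (upr (\<lambda>n. n + 2)) B) (Var 1) (Var 0)) (\<lambda>n. Var (n + 2)) n)
      = case_nat (Tuple (lift 2 (rename \<xi> A)) (rename (upr (\<lambda>n. n + 2)) (rename (upr \<xi>) B))
        (Var 1) (Var 0)) (\<lambda>n. Var (n + 2)) (upr \<xi> n)"
    by (cases n) (auto simp: lift_def rename_rename upr_def intro!: rename_cong split: nat.split)
qed

subsection \<open>Inversion and weakening\<close>

lemma conv_rename: "s \<simeq> t \<Longrightarrow> rename \<xi> s \<simeq> rename \<xi> t"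
proof (induction arbitrary: \<xi> rule: conv.induct)
  case (conv_sym s t) then show ?case by (blast intro: conv.conv_sym)
next
  case (conv_trans s t u) then show ?case by (meson conv.conv_trans)
next
  case (beta_App A b a) then show ?case by (simp add: rename_inst1 conv.beta_App)
next
  case (beta_Split P b A B x y) then show ?case by (simp add: rename_inst2 conv.beta_Split)
qed (simp_all add: conv.intros(1,6) cong_Pi cong_Lam cong_App cong_Sg cong_Tuple cong_Split cong_Eq cong_Refl cong_J
  cong_Funext cong_Uip)

lemma typing_wf: "\<Gamma> \<turnstile> t \<Colon> A \<Longrightarrow> \<turnstile> \<Gamma> ctx"
  by (induction rule: wf_ctx_typing.inducts(2)[where ?P1.0 = "\<lambda>_. True"]) auto

text \<open>The rule \<open>ty_conv\<close> changes only the type, so an induction with the subject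
  held fixed passes through it to a formation rule.\<close>

lemma Pi_inv:
  assumes "\<Gamma> \<turnstile> Pi A B \<Colon> T"
  obtains i j where "\<Gamma> \<turnstile> A \<Colon> Univ i" "A # \<Gamma> \<turnstile> B \<Colon> Univ j"
proof -
  have "\<Gamma> \<turnstile> t \<Colon> T \<Longrightarrow> t = Pi A B \<Longrightarrow> \<exists>i j. (\<Gamma> \<turnstile> A \<Colon> Univ i) \<and> (A # \<Gamma> \<turnstile> B \<Colon> Univ j)" for t
    by (induction arbitrary: A B rule: wf_ctx_typing.inducts(2)[where ?P1.0 = "\<lambda>_. True"]) auto
  then show ?thesis using assms that by blast
qed

lemma Sg_inv:
  assumes "\<Gamma> \<turnstile> Sg A B \<Colon> T"
  obtains i j where "\<Gamma> \<turnstile> A \<Colon> Univ i" "A # \<Gamma> \<turnstile> B \<Colon> Univ j"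
proof -
  have "\<Gamma> \<turnstile> t \<Colon> T \<Longrightarrow> t = Sg A B \<Longrightarrow> \<exists>i j. (\<Gamma> \<turnstile> A \<Colon> Univ i) \<and> (A # \<Gamma> \<turnstile> B \<Colon> Univ j)" for t
    by (induction arbitrary: A B rule: wf_ctx_typing.inducts(2)[where ?P1.0 = "\<lambda>_. True"]) auto
  then show ?thesis using assms that by blast
qed

text \<open>The two formation rules differ in whether the codomain lies in \<open>Univ 0\<close> or
  above; the existential level hides this case distinction.\<close>

lemma ty_Pi_ex:
  assumes "\<Gamma> \<turnstile> A \<Colon> Univ i" "A # \<Gamma> \<turnstile> B \<Colon> Univ j"
  shows "\<exists>k. \<Gamma> \<turnstile> Pi A B \<Colon> Univ k"
  using assms by (cases j) (blast intro: ty_Pi ty_Pi_impred)+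

text \<open>A well-typed renaming from \<open>\<Gamma>\<close> to \<open>\<Delta>\<close>. A context
  entry lives over the tail behind it, so both entries are lifted into their full contexts before
  they are compared.\<close>

definition ren :: "(nat \<Rightarrow> nat) \<Rightarrow> trm list \<Rightarrow> trm list \<Rightarrow> bool" where
  "ren \<xi> \<Gamma> \<Delta> \<longleftrightarrow> (\<turnstile> \<Delta> ctx) \<and> (\<forall>n < length \<Gamma>. \<xi> n < length \<Delta> \<and>
      lift (Suc (\<xi> n)) (\<Delta> ! \<xi> n) = rename \<xi> (lift (Suc n) (\<Gamma> ! n)))"

lemma ren_Cons:
  assumes "ren \<xi> \<Gamma> \<Delta>" "\<Delta> \<turnstile> rename \<xi> A \<Colon> Univ i"
  shows "ren (upr \<xi>) (A # \<Gamma>) (rename \<xi> A # \<Delta>)"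
  unfolding ren_def
proof (intro conjI allI impI)
  show "\<turnstile> rename \<xi> A # \<Delta> ctx" using assms by (auto simp: ren_def intro: wf_Cons)
next
  fix n assume n: "n < length (A # \<Gamma>)"
  then show "upr \<xi> n < length (rename \<xi> A # \<Delta>)"
    using assms(1) by (cases n) (auto simp: ren_def)
  show "lift (Suc (upr \<xi> n)) ((rename \<xi> A # \<Delta>) ! upr \<xi> n) = rename (upr \<xi>) (lift (Suc n) ((A # \<Gamma>) ! n))"
  proof (cases n)
    case 0 then show ?thesis by (simp add: lift_def rename_rename)
  next
    case (Suc m)
    then have *: "lift (Suc (\<xi> m)) (\<Delta> ! \<xi> m) = rename \<xi> (lift (Suc m) (\<Gamma> ! m))"
      using n assms(1) by (auto simp: ren_def)
    have "rename Suc (lift (Suc (\<xi> m)) (\<Delta> ! \<xi> m)) = rename Suc (rename \<xi> (lift (Suc m) (\<Gamma> ! m)))"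
      by (simp only: *)
    then show ?thesis by (simp add: lift_def rename_rename Suc)
  qed
qed

text \<open>
  The rules for \<open>Split\<close> and \<open>J\<close> mention the types of their bound variables only
  in contexts, so the induction must also provide that renamed context entries are types.
\<close>

lemma typing_rename_aux:
  "\<turnstile> \<Gamma> ctx \<Longrightarrow> (\<forall>\<Gamma>1 A \<Gamma>0. \<Gamma> = \<Gamma>1 @ A # \<Gamma>0 \<longrightarrow> (\<forall>\<Delta> \<xi>. ren \<xi> \<Gamma>0 \<Delta> \<longrightarrow> (\<exists>i. \<Delta> \<turnstile> rename \<xi> A \<Colon> Univ i)))"
  "\<Gamma> \<turnstile> t \<Colon> T \<Longrightarrow> (\<forall>\<Gamma>1 A \<Gamma>0. \<Gamma> = \<Gamma>1 @ A # \<Gamma>0 \<longrightarrow> (\<forall>\<Delta> \<xi>. ren \<xi> \<Gamma>0 \<Delta> \<longrightarrow> (\<exists>i. \<Delta> \<turnstile> rename \<xi> A \<Colon> Univ i)))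
     \<and> (\<forall>\<Delta> \<xi>. ren \<xi> \<Gamma> \<Delta> \<longrightarrow> \<Delta> \<turnstile> rename \<xi> t \<Colon> rename \<xi> T)"
proof (induction rule: wf_ctx_typing.inducts)
  case wf_Nil then show ?case by simp
next
  case (wf_Cons \<Gamma> A i)
  show ?case
  proof (intro allI impI)
    fix \<Gamma>1 A' \<Gamma>0 \<Delta> \<xi> assume eq: "A # \<Gamma> = \<Gamma>1 @ A' # \<Gamma>0" and r: "ren \<xi> \<Gamma>0 \<Delta>"
    show "\<exists>i. \<Delta> \<turnstile> rename \<xi> A' \<Colon> Univ i"
    proof (cases \<Gamma>1)
      case Nil
      then show ?thesis using eq r wf_Cons.IH(2) by auto blast
    next
      case (Cons B \<Gamma>2)
      then have "\<Gamma> = \<Gamma>2 @ A' # \<Gamma>0" using eq by simp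
      then show ?thesis using r wf_Cons.IH(1) by blast
    qed
  qed
next
  case (ty_Var \<Gamma> n)
  have "\<Delta> \<turnstile> Var (\<xi> n) \<Colon> rename \<xi> (lift (Suc n) (\<Gamma> ! n))" if "ren \<xi> \<Gamma> \<Delta>" for \<Delta> \<xi>
    using that ty_Var.hyps wf_ctx_typing.ty_Var[of \<Delta> "\<xi> n"] by (simp add: ren_def)
  with ty_Var.IH show ?case by simp
next
  case (ty_Univ \<Gamma> i) then show ?case by (auto simp: ren_def intro: wf_ctx_typing.ty_Univ)
next
  case (ty_conv \<Gamma> t A B i)
  have "\<Delta> \<turnstile> rename \<xi> t \<Colon> rename \<xi> B" if "ren \<xi> \<Gamma> \<Delta>" for \<Delta> \<xi>
    using that ty_conv.IH wf_ctx_typing.ty_conv[OF _ conv_rename[OF ty_conv.hyps(2)]] by fastforce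
  with ty_conv.IH show ?case by simp
next
  case (ty_Pi \<Gamma> A i B j)
  have "\<Delta> \<turnstile> Pi (rename \<xi> A) (rename (upr \<xi>) B) \<Colon> Univ (max i (Suc j))" if r: "ren \<xi> \<Gamma> \<Delta>" for \<Delta> \<xi>
  proof -
    have A: "\<Delta> \<turnstile> rename \<xi> A \<Colon> Univ i" using ty_Pi.IH(1) r by fastforce
    show ?thesis using wf_ctx_typing.ty_Pi[OF A] ty_Pi.IH(2) ren_Cons[OF r A] by fastforce
  qed
  with ty_Pi.IH show ?case by simp
next
  case (ty_Pi_impred \<Gamma> A i B)
  have "\<Delta> \<turnstile> Pi (rename \<xi> A) (rename (upr \<xi>) B) \<Colon> Univ 0" if r: "ren \<xi> \<Gamma> \<Delta>" for \<Delta> \<xi>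
  proof -
    have A: "\<Delta> \<turnstile> rename \<xi> A \<Colon> Univ i" using ty_Pi_impred.IH(1) r by fastforce
    show ?thesis using wf_ctx_typing.ty_Pi_impred[OF A] ty_Pi_impred.IH(2) ren_Cons[OF r A] by fastforce
  qed
  with ty_Pi_impred.IH show ?case by simp
next
  case (ty_Lam \<Gamma> A B i b)
  have "\<Delta> \<turnstile> rename \<xi> (Lam A b) \<Colon> rename \<xi> (Pi A B)" if r: "ren \<xi> \<Gamma> \<Delta>" for \<Delta> \<xi>
  proof -
    have *: "\<Delta> \<turnstile> Pi (rename \<xi> A) (rename (upr \<xi>) B) \<Colon> Univ i" using ty_Lam r by fastforce
    then obtain k where A: "\<Delta> \<turnstile> rename \<xi> A \<Colon> Univ k" by (meson Pi_inv)
    have "rename \<xi> A # \<Delta> \<turnstile> rename (upr \<xi>) b \<Colon> rename (upr \<xi>) B"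
      using ty_Lam.IH(2) ren_Cons[OF r A] by blast
    with * show ?thesis by (simp add: wf_ctx_typing.ty_Lam)
  qed
  with ty_Lam.IH show ?case by simp
next
  case (ty_App \<Gamma> f A B a)
  have "\<Delta> \<turnstile> rename \<xi> f \<cdot> rename \<xi> a \<Colon> rename \<xi> (inst1 B a)" if r: "ren \<xi> \<Gamma> \<Delta>" for \<Delta> \<xi>
    unfolding rename_inst1 by (rule wf_ctx_typing.ty_App) (use ty_App.IH r in fastforce)+
  with ty_App.IH show ?case by simp
next
  case (ty_Sg \<Gamma> A i B j)
  have "\<Delta> \<turnstile> Sg (rename \<xi> A) (rename (upr \<xi>) B) \<Colon> Univ (max i j)" if r: "ren \<xi> \<Gamma> \<Delta>" for \<Delta> \<xi>
  proof -
    have A: "\<Delta> \<turnstile> rename \<xi> A \<Colon> Univ i" using ty_Sg.IH(1) r by fastforce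
    show ?thesis using wf_ctx_typing.ty_Sg[OF A] ty_Sg.IH(2) ren_Cons[OF r A] by fastforce
  qed
  with ty_Sg.IH show ?case by simp
next
  case (ty_Tuple \<Gamma> A B i a b)
  have "\<Delta> \<turnstile> Tuple (rename \<xi> A) (rename (upr \<xi>) B) (rename \<xi> a) (rename \<xi> b) \<Colon>
      Sg (rename \<xi> A) (rename (upr \<xi>) B)" if r: "ren \<xi> \<Gamma> \<Delta>" for \<Delta> \<xi>
    by (rule wf_ctx_typing.ty_Tuple) (use ty_Tuple.IH r in \<open>fastforce simp: rename_inst1\<close>)+
  with ty_Tuple.IH show ?case by simp
next
  case (ty_Split \<Gamma> t A B P i b)
  have "\<Delta> \<turnstile> rename \<xi> (Split P b t) \<Colon> rename \<xi> (inst1 P t)" if r: "ren \<xi> \<Gamma> \<Delta>" for \<Delta> \<xi>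
  proof -
    have t: "\<Delta> \<turnstile> rename \<xi> t \<Colon> Sg (rename \<xi> A) (rename (upr \<xi>) B)" using ty_Split r by fastforce
    \<comment> \<open>The part of the hypothesis about context entries, taken at the head of the
      context of \<open>P\<close>, makes the renamed pair type well formed, so that the renaming can
      go under this binder.\<close>
    obtain k where k: "\<Delta> \<turnstile> rename \<xi> (Sg A B) \<Colon> Univ k" using ty_Split.IH(2) r by blast
    have P: "Sg (rename \<xi> A) (rename (upr \<xi>) B) # \<Delta> \<turnstile> rename (upr \<xi>) P \<Colon> Univ i"
      using ty_Split.IH(2) ren_Cons[OF r k] by auto
    \<comment> \<open>One context is split in two ways: with \<open>A\<close> behind
      \<open>B\<close> for the type of the outer bound variable, and with \<open>B\<close> at the
      head for that of the inner one.\<close>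
    have "B # A # \<Gamma> = [B] @ A # \<Gamma>" "B # A # \<Gamma> = [] @ B # A # \<Gamma>" by auto
    then obtain k1 where k1: "\<Delta> \<turnstile> rename \<xi> A \<Colon> Univ k1" using ty_Split.IH(3) r by blast
    note r1 = ren_Cons[OF r k1]
    then obtain k2 where k2: "rename \<xi> A # \<Delta> \<turnstile> rename (upr \<xi>) B \<Colon> Univ k2"
      using ty_Split.IH(3) \<open>B # A # \<Gamma> = [] @ B # A # \<Gamma>\<close> by blast
    note r2 = ren_Cons[OF r1 k2]
    show ?thesis
      unfolding rename.simps rename_inst1
      by (rule wf_ctx_typing.ty_Split[OF t P]) (use ty_Split.IH(3) r2 rename_Split_branch in metis)
  qed
  with ty_Split.IH show ?case by simp
next
  case (ty_Eq \<Gamma> A i a b) then show ?case by (simp add: wf_ctx_typing.ty_Eq)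
next
  case (ty_Refl \<Gamma> a A) then show ?case by (simp add: wf_ctx_typing.ty_Refl)
next
  case (ty_J \<Gamma> p A a b P i d)
  let ?E = "Eq (lift 1 A) (lift 1 a) (Var 0)"
  have "\<Delta> \<turnstile> rename \<xi> (J P d p) \<Colon> rename \<xi> (inst2 P b p)" if r: "ren \<xi> \<Gamma> \<Delta>" for \<Delta> \<xi>
  proof -
    have c: "?E # A # \<Gamma> = [?E] @ A # \<Gamma>" "?E # A # \<Gamma> = [] @ ?E # A # \<Gamma>" by auto
    then obtain k1 where k1: "\<Delta> \<turnstile> rename \<xi> A \<Colon> Univ k1" using ty_J.IH(2) r by blast
    note r1 = ren_Cons[OF r k1]
    then obtain k2 where k2: "rename \<xi> A # \<Delta> \<turnstile> rename (upr \<xi>) ?E \<Colon> Univ k2"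
      using ty_J.IH(2) c by blast
    have "rename (upr \<xi>) ?E = Eq (lift 1 (rename \<xi> A)) (lift 1 (rename \<xi> a)) (Var 0)"
      by (simp add: lift_def rename_rename)
    then have P: "Eq (lift 1 (rename \<xi> A)) (lift 1 (rename \<xi> a)) (Var 0) # rename \<xi> A # \<Delta> \<turnstile> rename (upr (upr \<xi>)) P \<Colon> Univ i"
      using ty_J.IH(2) ren_Cons[OF r1 k2] by auto
    show ?thesis unfolding rename.simps rename_inst2
      by (rule wf_ctx_typing.ty_J[OF _ P]) (use ty_J.IH(1,3) r in \<open>fastforce simp: rename_inst2\<close>)+
  qed
  with ty_J.IH show ?case by simp
next
  case (ty_Funext \<Gamma> f A B g h)
  then show ?case
    by (simp add: rename_rename lift_def wf_ctx_typing.ty_Funext)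
next
  case (ty_Uip \<Gamma> p A a b q) then show ?case by (simp add: wf_ctx_typing.ty_Uip)
qed

lemmas typing_rename = typing_rename_aux(2)[THEN conjunct2, rule_format]

lemma weakening:
  assumes "\<Gamma> \<turnstile> t \<Colon> A" "\<turnstile> \<Delta> @ \<Gamma> ctx" "k = length \<Delta>"
  shows "\<Delta> @ \<Gamma> \<turnstile> lift k t \<Colon> lift k A"
  unfolding lift_def
  by (rule typing_rename[OF assms(1)])
    (use assms in \<open>auto simp: ren_def lift_def rename_rename nth_append ac_simps\<close>)

section \<open>Substitution through the defined notions\<close>

lemmas de_bruijn = lift_def inst1_def inst2_def rename_eq_subst subst_subst eval_nat_numeral

lemma lift_lift [simp]: "lift j (lift k t) = lift (j + k) t"
  by (simp add: lift_def rename_rename ac_simps)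

lemma lift_0 [simp]: "lift 0 t = t"
  by (simp add: lift_def rename_eq_subst)

lemma lift_simps [simp]:
  "lift k (Var n) = Var (n + k)" "lift k (Univ i) = Univ i" "lift k (f \<cdot> a) = lift k f \<cdot> lift k a"
  "lift k (Eq A a b) = Eq (lift k A) (lift k a) (lift k b)"
  by (simp_all add: lift_def)

lemma inst1_lift [simp]: "inst1 (lift (Suc k) t) a = lift k t"
  by (simp add: de_bruijn)

lemma inst1_simps [simp]:
  "inst1 (Var 0) a = a" "inst1 (Var (Suc n)) a = Var n" "inst1 (f \<cdot> b) a = inst1 f a \<cdot> inst1 b a"
  "inst1 (Eq A x y) a = Eq (inst1 A a) (inst1 x a) (inst1 y a)"
  by (simp_all add: inst1_def)

text \<open>Weakening a family past a new variable and then instantiating it at that variable cancel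
  out. This gives \<open>lift 1 f \<cdot> Var 0\<close> the original codomain as its type.\<close>

lemma inst1_rename_upr_Suc: "inst1 (rename (upr Suc) B) (Var 0) = B"
proof -
  have "inst1 (rename (upr Suc) B) (Var 0) = subst Var B"
    unfolding inst1_def subst_rename by (rule subst_cong) (simp add: upr_def split: nat.split)
  then show ?thesis by simp
qed

lemma subst_Arr: "subst \<sigma> (A \<rightarrow> B) = subst \<sigma> A \<rightarrow> subst \<sigma> B"
  by (simp add: Arr_def de_bruijn)

lemma subst_compose: "subst \<sigma> (compose D f g) = compose (subst \<sigma> D) (subst \<sigma> f) (subst \<sigma> g)"
  by (simp add: compose_def de_bruijn)

lemma subst_proj1: "subst \<sigma> (proj1 A t) = proj1 (subst \<sigma> A) (subst \<sigma> t)"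
  by (simp add: proj1_def de_bruijn)

lemma subst_EqCls:
  "subst \<sigma> (EqCls D R C f) = EqCls (subst \<sigma> D) (subst \<sigma> R) (subst \<sigma> C) (subst \<sigma> f)"
  by (simp add: EqCls_def subst_Arr de_bruijn)

lemma subst_quot_star: "subst \<sigma> (quot_star D R) = quot_star (subst \<sigma> D) (subst \<sigma> R)"
  by (simp add: quot_star_def subst_EqCls subst_Arr de_bruijn)

lemma subst_cls_star:
  "subst \<sigma> (cls_star D R d) = cls_star (subst \<sigma> D) (subst \<sigma> R) (subst \<sigma> d)"
  by (simp add: cls_star_def subst_EqCls subst_Arr de_bruijn)

lemma subst_rec_star:
  "subst \<sigma> (rec_star C f H q) = rec_star (subst \<sigma> C) (subst \<sigma> f) (subst \<sigma> H) (subst \<sigma> q)"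
  by (simp add: rec_star_def)

lemma subst_LimQuot: "subst \<sigma> (LimQuot D R q) = LimQuot (subst \<sigma> D) (subst \<sigma> R) (subst \<sigma> q)"
  by (simp add: LimQuot_def subst_EqCls subst_Arr subst_compose subst_rec_star de_bruijn)

lemma subst_quot: "subst \<sigma> (quot D R) = quot (subst \<sigma> D) (subst \<sigma> R)"
  by (simp add: quot_def subst_quot_star subst_LimQuot de_bruijn)

lemma subst_LimCls: "subst \<sigma> (LimCls D R) = LimCls (subst \<sigma> D) (subst \<sigma> R)"
  by (simp add: LimCls_def subst_cls_star subst_LimQuot de_bruijn)

lemma subst_cls: "subst \<sigma> (cls D R p) = cls (subst \<sigma> D) (subst \<sigma> R) (subst \<sigma> p)"
  by (simp add: cls_def subst_cls_star subst_LimQuot subst_quot_star de_bruijn)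

lemma subst_rec_q: "subst \<sigma> (rec_q D R C f H) =
    rec_q (subst \<sigma> D) (subst \<sigma> R) (subst \<sigma> C) (subst \<sigma> f) (subst \<sigma> H)"
  by (simp add: rec_q_def subst_rec_star subst_proj1 subst_quot subst_quot_star de_bruijn)

lemmas subst_defs = subst_Arr subst_compose subst_proj1 subst_EqCls subst_quot_star subst_cls_star
  subst_rec_star subst_LimQuot subst_quot subst_LimCls subst_cls subst_rec_q

lemma lift_defs [simp]:
  "lift k (A \<rightarrow> B) = lift k A \<rightarrow> lift k B"
  "lift k (compose D f g) = compose (lift k D) (lift k f) (lift k g)"
  "lift k (proj1 A t) = proj1 (lift k A) (lift k t)"
  "lift k (EqCls D R C f) = EqCls (lift k D) (lift k R) (lift k C) (lift k f)"
  "lift k (quot_star D R) = quot_star (lift k D) (lift k R)"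
  "lift k (cls_star D R d) = cls_star (lift k D) (lift k R) (lift k d)"
  "lift k (rec_star C f H q) = rec_star (lift k C) (lift k f) (lift k H) (lift k q)"
  "lift k (LimQuot D R q) = LimQuot (lift k D) (lift k R) (lift k q)"
  "lift k (quot D R) = quot (lift k D) (lift k R)"
  "lift k (LimCls D R) = LimCls (lift k D) (lift k R)"
  "lift k (cls D R p) = cls (lift k D) (lift k R) (lift k p)"
  "lift k (rec_q D R C f H) = rec_q (lift k D) (lift k R) (lift k C) (lift k f) (lift k H)"
  by (simp_all add: lift_def rename_eq_subst subst_defs)

lemma inst1_defs [simp]:
  "inst1 (A \<rightarrow> B) a = inst1 A a \<rightarrow> inst1 B a"
  "inst1 (compose D f g) a = compose (inst1 D a) (inst1 f a) (inst1 g a)"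
  "inst1 (proj1 A t) a = proj1 (inst1 A a) (inst1 t a)"
  "inst1 (EqCls D R C f) a = EqCls (inst1 D a) (inst1 R a) (inst1 C a) (inst1 f a)"
  "inst1 (quot_star D R) a = quot_star (inst1 D a) (inst1 R a)"
  "inst1 (cls_star D R d) a = cls_star (inst1 D a) (inst1 R a) (inst1 d a)"
  "inst1 (rec_star C f H q) a = rec_star (inst1 C a) (inst1 f a) (inst1 H a) (inst1 q a)"
  "inst1 (LimQuot D R q) a = LimQuot (inst1 D a) (inst1 R a) (inst1 q a)"
  "inst1 (quot D R) a = quot (inst1 D a) (inst1 R a)"
  "inst1 (cls D R p) a = cls (inst1 D a) (inst1 R a) (inst1 p a)"
  "inst1 (rec_q D R C f H) a = rec_q (inst1 D a) (inst1 R a) (inst1 C a) (inst1 f a) (inst1 H a)"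
  by (simp_all add: inst1_def subst_defs)

subsection \<open>Inhabited types, identity types and propositions\<close>

lemma wf_ctx_Cons_inv:
  assumes "\<turnstile> A # \<Gamma> ctx" obtains i where "\<Gamma> \<turnstile> A \<Colon> Univ i"
  using assms by (cases rule: wf_ctx.cases) auto

lemma weakening1:
  assumes "\<Gamma> \<turnstile> t \<Colon> A" "\<turnstile> B # \<Gamma> ctx"
  shows "B # \<Gamma> \<turnstile> lift 1 t \<Colon> lift 1 A"
  using weakening[OF assms(1), of "[B]"] assms by simp

lemma ty_Var_eq: "\<turnstile> \<Gamma> ctx \<Longrightarrow> n < length \<Gamma> \<Longrightarrow> lift (Suc n) (\<Gamma> ! n) = A \<Longrightarrow> \<Gamma> \<turnstile> Var n \<Colon> A"
  using ty_Var by blast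

lemma ty_Arr:
  assumes "\<Gamma> \<turnstile> A \<Colon> Univ i" "\<Gamma> \<turnstile> B \<Colon> \<U>"
  shows "\<Gamma> \<turnstile> A \<rightarrow> B \<Colon> \<U>"
proof -
  have "\<turnstile> A # \<Gamma> ctx" using assms typing_wf wf_Cons by blast
  then show ?thesis unfolding Arr_def using assms weakening1[OF assms(2)] by (simp add: ty_Pi_impred)
qed

lemma ty_Arr_App: "\<Gamma> \<turnstile> f \<Colon> A \<rightarrow> B \<Longrightarrow> \<Gamma> \<turnstile> a \<Colon> A \<Longrightarrow> \<Gamma> \<turnstile> f \<cdot> a \<Colon> B"
  unfolding Arr_def by (metis One_nat_def inst1_lift lift_0 ty_App)

definition inh :: "trm list \<Rightarrow> trm \<Rightarrow> bool" where
  "inh \<Gamma> A \<longleftrightarrow> (\<exists>t. \<Gamma> \<turnstile> t \<Colon> A)"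

lemma inhI: "\<Gamma> \<turnstile> t \<Colon> A \<Longrightarrow> inh \<Gamma> A"
  by (auto simp: inh_def)

lemma inh_conv: "inh \<Gamma> A \<Longrightarrow> A \<simeq> B \<Longrightarrow> \<Gamma> \<turnstile> B \<Colon> Univ i \<Longrightarrow> inh \<Gamma> B"
  unfolding inh_def using ty_conv by blast

lemma inh_Pi:
  assumes "\<Gamma> \<turnstile> Pi A B \<Colon> Univ i" "inh (A # \<Gamma>) B" shows "inh \<Gamma> (Pi A B)"
  using assms unfolding inh_def by (blast intro: ty_Lam)

lemma inh_Arr:
  assumes "\<Gamma> \<turnstile> A \<rightarrow> B \<Colon> Univ i" "inh (A # \<Gamma>) (lift 1 B)" shows "inh \<Gamma> (A \<rightarrow> B)"
  using assms unfolding Arr_def by (rule inh_Pi)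

lemma inh_Arr_App: "inh \<Gamma> (A \<rightarrow> B) \<Longrightarrow> inh \<Gamma> A \<Longrightarrow> inh \<Gamma> B"
  unfolding inh_def using ty_Arr_App by blast

text \<open>The motive given to \<open>J\<close> is \<open>P\<close> weakened past the path
  variable, so path induction becomes replacement of equals. Symmetry, transitivity, congruence and
  the equality of pairs are obtained below by choosing \<open>P\<close>.\<close>

lemma inh_transport:
  assumes e: "inh \<Gamma> (Eq A a b)" and a: "\<Gamma> \<turnstile> a \<Colon> A" and P: "A # \<Gamma> \<turnstile> P \<Colon> Univ i"
    and Pa: "inh \<Gamma> (inst1 P a)"
  shows "inh \<Gamma> (inst1 P b)"
proof -
  have eq: "inst2 (lift 1 P) x y = inst1 P x" for x y by (simp add: de_bruijn)
  from P obtain k where k: "\<Gamma> \<turnstile> A \<Colon> Univ k" and c: "\<turnstile> A # \<Gamma> ctx"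
    using typing_wf wf_ctx_Cons_inv by metis
  let ?E = "Eq (lift 1 A) (lift 1 a) (Var 0)"
  have "A # \<Gamma> \<turnstile> ?E \<Colon> Univ k"
    using weakening1[OF k c] weakening1[OF a c] c by (auto intro!: ty_Eq ty_Var_eq)
  then have "\<turnstile> ?E # A # \<Gamma> ctx" using c wf_Cons by blast
  from weakening1[OF P this] have "?E # A # \<Gamma> \<turnstile> lift 1 P \<Colon> Univ i" by simp
  from ty_J[OF _ this] show ?thesis using e Pa unfolding eq inh_def by blast
qed

lemma inh_refl: "\<Gamma> \<turnstile> a \<Colon> A \<Longrightarrow> inh \<Gamma> (Eq A a a)"
  using ty_Refl inhI by blast

lemma inh_sym:
  assumes "inh \<Gamma> (Eq A a b)" "\<Gamma> \<turnstile> a \<Colon> A" "\<Gamma> \<turnstile> A \<Colon> Univ i"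
  shows "inh \<Gamma> (Eq A b a)"
proof -
  have c: "\<turnstile> A # \<Gamma> ctx" using assms typing_wf wf_Cons by blast
  have "A # \<Gamma> \<turnstile> Eq (lift 1 A) (Var 0) (lift 1 a) \<Colon> Univ i"
    using weakening1[OF assms(3) c] weakening1[OF assms(2) c] c by (auto intro!: ty_Eq ty_Var_eq)
  from inh_transport[OF assms(1,2) this] show ?thesis using inh_refl[OF assms(2)] by simp
qed

lemma inh_trans:
  assumes "inh \<Gamma> (Eq A a b)" "inh \<Gamma> (Eq A b c)" "\<Gamma> \<turnstile> a \<Colon> A" "\<Gamma> \<turnstile> b \<Colon> A" "\<Gamma> \<turnstile> A \<Colon> Univ i"
  shows "inh \<Gamma> (Eq A a c)"
proof -
  have c: "\<turnstile> A # \<Gamma> ctx" using assms typing_wf wf_Cons by blast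
  have "A # \<Gamma> \<turnstile> Eq (lift 1 A) (lift 1 a) (Var 0) \<Colon> Univ i"
    using weakening1[OF assms(5) c] weakening1[OF assms(3) c] c by (auto intro!: ty_Eq ty_Var_eq)
  from inh_transport[OF assms(2,4) this] show ?thesis using assms(1) by simp
qed

lemma inh_cong:
  assumes f: "\<Gamma> \<turnstile> f \<Colon> A \<rightarrow> B" and e: "inh \<Gamma> (Eq A a b)" and a: "\<Gamma> \<turnstile> a \<Colon> A"
    and A: "\<Gamma> \<turnstile> A \<Colon> Univ i" and B: "\<Gamma> \<turnstile> B \<Colon> Univ j"
  shows "inh \<Gamma> (Eq B (f \<cdot> a) (f \<cdot> b))"
proof -
  have c: "\<turnstile> A # \<Gamma> ctx" using A typing_wf wf_Cons by blast
  have v: "A # \<Gamma> \<turnstile> Var 0 \<Colon> lift 1 A" using c by (auto intro!: ty_Var_eq)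
  note fa = ty_Arr_App[OF f a]
  have "A # \<Gamma> \<turnstile> Eq (lift 1 B) (lift 1 (f \<cdot> a)) (lift 1 f \<cdot> Var 0) \<Colon> Univ j"
    using weakening1[OF B c] weakening1[OF fa c] ty_Arr_App[OF weakening1[OF f c, simplified lift_defs] v]
    by (auto intro!: ty_Eq)
  from inh_transport[OF e a this] show ?thesis using inh_refl[OF fa] by simp
qed

lemma ty_eta_body:
  assumes "\<Gamma> \<turnstile> f \<Colon> Pi A B" "\<turnstile> A # \<Gamma> ctx"
  shows "A # \<Gamma> \<turnstile> lift 1 f \<cdot> Var 0 \<Colon> B"
proof -
  have "A # \<Gamma> \<turnstile> Var 0 \<Colon> lift 1 A" using assms by (auto intro!: ty_Var_eq)
  moreover have "A # \<Gamma> \<turnstile> lift 1 f \<Colon> Pi (lift 1 A) (rename (upr Suc) B)"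
    using weakening1[OF assms] by (simp add: lift_def)
  ultimately have "A # \<Gamma> \<turnstile> lift 1 f \<cdot> Var 0 \<Colon> inst1 (rename (upr Suc) B) (Var 0)" by (rule ty_App[rotated])
  then show ?thesis by (simp add: inst1_rename_upr_Suc)
qed

lemma inh_funext:
  assumes T: "\<Gamma> \<turnstile> Pi A B \<Colon> Univ i" and f: "\<Gamma> \<turnstile> f \<Colon> Pi A B" and g: "\<Gamma> \<turnstile> g \<Colon> Pi A B"
    and e: "inh (A # \<Gamma>) (Eq B (lift 1 f \<cdot> Var 0) (lift 1 g \<cdot> Var 0))"
  shows "inh \<Gamma> (Eq (Pi A B) f g)"
proof -
  from T obtain j k where A: "\<Gamma> \<turnstile> A \<Colon> Univ j" and B: "A # \<Gamma> \<turnstile> B \<Colon> Univ k" by (rule Pi_inv)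
  note c = typing_wf[OF B]
  obtain l where "\<Gamma> \<turnstile> Pi A (Eq B (lift 1 f \<cdot> Var 0) (lift 1 g \<cdot> Var 0)) \<Colon> Univ l"
    using ty_Pi_ex[OF A ty_Eq[OF B ty_eta_body[OF f c] ty_eta_body[OF g c]]] by blast
  from inh_Pi[OF this e] show ?thesis using ty_Funext[OF f g] by (auto simp: inh_def)
qed

text \<open>A condition on the terms of one fixed context, not a type of the object theory. The
  definition does not by itself pass to larger contexts, so where a fresh variable is one of the
  compared elements, it is required in the extended context.\<close>

definition isprop :: "trm list \<Rightarrow> trm \<Rightarrow> bool" where
  "isprop \<Gamma> A \<longleftrightarrow> (\<forall>a b. \<Gamma> \<turnstile> a \<Colon> A \<longrightarrow> \<Gamma> \<turnstile> b \<Colon> A \<longrightarrow> inh \<Gamma> (Eq A a b))"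

text \<open>Function extensionality reduces two functions to their values at a fresh variable, and
  these lie in a proposition.\<close>

lemma isprop_Pi:
  assumes "\<Gamma> \<turnstile> Pi A B \<Colon> Univ i" "\<And>j. A # \<Gamma> \<turnstile> B \<Colon> Univ j \<Longrightarrow> isprop (A # \<Gamma>) B"
  shows "isprop \<Gamma> (Pi A B)"
proof -
  from assms(1) obtain k where B: "A # \<Gamma> \<turnstile> B \<Colon> Univ k" by (rule Pi_inv)
  note c = typing_wf[OF B]
  show ?thesis using assms(2)[OF B] inh_funext[OF assms(1)] ty_eta_body[OF _ c] unfolding isprop_def by blast
qed

lemma isprop_Eq: "isprop \<Gamma> (Eq A a b)"
  using ty_Uip inhI unfolding isprop_def by blast

section \<open>Equality of dependent pairs\<close>

lemma lift_Sg: "lift k (Sg A B) = Sg (lift k A) (rename (upr (\<lambda>n. n + k)) B)"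
  by (simp add: lift_def)

lemma lift_Tuple: "lift k (Tuple A B x y) =
    Tuple (lift k A) (rename (upr (\<lambda>n. n + k)) B) (lift k x) (lift k y)"
  by (simp add: lift_def)

lemma inst1_rename_upr_lift: "inst1 (rename (upr (\<lambda>n. n + k)) B) (lift k a) = lift k (inst1 B a)"
  by (simp add: lift_def rename_inst1)

lemma subst_rename_upr_Suc:
  "subst (ups (case_nat a Var)) (rename (upr (\<lambda>n. n + Suc k)) B) = rename (upr (\<lambda>n. n + k)) B"
  unfolding rename_eq_subst subst_subst
  by (rule subst_cong) (simp add: upr_def subst_rename split: nat.split)

lemma inst1_Tuple_lift:
  "inst1 (Tuple (lift (Suc k) A) (rename (upr (\<lambda>n. n + Suc k)) B) x y) a =
    Tuple (lift k A) (rename (upr (\<lambda>n. n + k)) B) (inst1 x a) (inst1 y a)"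
proof -
  have "inst1 (Tuple (lift (Suc k) A) (rename (upr (\<lambda>n. n + Suc k)) B) x y) a =
     Tuple (inst1 (lift (Suc k) A) a) (subst (ups (case_nat a Var)) (rename (upr (\<lambda>n. n + Suc k)) B)) (inst1 x a) (inst1 y a)"
    by (simp add: inst1_def)
  then show ?thesis by (simp only: subst_rename_upr_Suc inst1_lift)
qed

lemma rename_upr_0: "rename (upr (\<lambda>n. n + 0)) B = B"
proof -
  have "upr (\<lambda>n. n + 0) = (\<lambda>n. n)" by (auto simp: upr_def split: nat.split)
  then show ?thesis by (simp only: rename_eq_subst subst_Var)
qed

lemma inh_Tuple_eq_snd:
  assumes T: "\<Gamma> \<turnstile> Sg A B \<Colon> Univ i" and a: "\<Gamma> \<turnstile> a \<Colon> A" and b: "\<Gamma> \<turnstile> b \<Colon> inst1 B a"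
    and T1: "\<Gamma> \<turnstile> inst1 B a \<Colon> Univ j" and e: "inh \<Gamma> (Eq (inst1 B a) b b')"
  shows "inh \<Gamma> (Eq (Sg A B) (Tuple A B a b) (Tuple A B a b'))"
proof -
  have c: "\<turnstile> inst1 B a # \<Gamma> ctx" using T1 typing_wf wf_Cons by blast
  note t = ty_Tuple[OF T a b]
  let ?t = "Tuple (lift 1 A) (rename (upr (\<lambda>n. n + 1)) B) (lift 1 a) (Var 0)"
  let ?P = "Eq (lift 1 (Sg A B)) (lift 1 (Tuple A B a b)) ?t"
  have "inst1 B a # \<Gamma> \<turnstile> ?t \<Colon> lift 1 (Sg A B)"
    unfolding lift_Sg
    by (rule ty_Tuple) (use weakening1[OF T c] weakening1[OF a c] c in
      \<open>auto simp: lift_Sg inst1_rename_upr_lift[of 1, simplified] intro!: ty_Var_eq\<close>)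
  then have P: "inst1 B a # \<Gamma> \<turnstile> ?P \<Colon> Univ i"
    using weakening1[OF T c] weakening1[OF t c] by (simp add: ty_Eq)
  have i: "inst1 ?P x = Eq (Sg A B) (Tuple A B a b) (Tuple A B a x)" for x
    using inst1_Tuple_lift[of 0 A B "lift 1 a" "Var 0" x] unfolding rename_upr_0 by simp
  from inh_transport[OF e b P] show ?thesis unfolding i using inh_refl[OF t] by blast
qed

text \<open>The second components live in the different types \<open>inst1 B a\<close> and
  \<open>inst1 B a'\<close>, so the transported statement quantifies over the second component: at
  \<open>x\<close> it says that the pair of \<open>a\<close> and \<open>b\<close> equals the pair of
  \<open>x\<close> and \<open>y\<close> for all \<open>y\<close> in the fibre over \<open>x\<close>.
  At \<open>a\<close> this is the case of a common first component, settled because the fibre is a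
  proposition; at \<open>a'\<close> the transported function is applied to
  \<open>b'\<close>.\<close>

lemma inh_Tuple_eq:
  assumes T: "\<Gamma> \<turnstile> Sg A B \<Colon> Univ i" and a: "\<Gamma> \<turnstile> a \<Colon> A"
    and b: "\<Gamma> \<turnstile> b \<Colon> inst1 B a" and b': "\<Gamma> \<turnstile> b' \<Colon> inst1 B a'"
    and e: "inh \<Gamma> (Eq A a a')"
    and T1: "\<Gamma> \<turnstile> inst1 B a \<Colon> Univ j" and pr: "isprop (inst1 B a # \<Gamma>) (lift 1 (inst1 B a))"
  shows "inh \<Gamma> (Eq (Sg A B) (Tuple A B a b) (Tuple A B a' b'))"
proof -
  obtain k l where A: "\<Gamma> \<turnstile> A \<Colon> Univ k" and B: "A # \<Gamma> \<turnstile> B \<Colon> Univ l" using T by (rule Sg_inv)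
  note cA = typing_wf[OF B]
  then have cB: "\<turnstile> B # A # \<Gamma> ctx" using B wf_Cons by blast
  note t = ty_Tuple[OF T a b]
  have iB: "inst1 (rename (upr (\<lambda>n. n + 2)) B) (Var 1) = lift 1 B"
    unfolding inst1_def subst_rename lift_def rename_eq_subst subst_subst
    by (rule subst_cong) (simp add: upr_def split: nat.split)
  let ?Q = "Eq (lift 2 (Sg A B)) (lift 2 (Tuple A B a b))
     (Tuple (lift 2 A) (rename (upr (\<lambda>n. n + 2)) B) (Var 1) (Var 0))"
  have T2: "B # A # \<Gamma> \<turnstile> Sg (lift 2 A) (rename (upr (\<lambda>n. n + 2)) B) \<Colon> Univ i"
    using weakening[OF T, of "[B, A]" 2] cB by (simp add: lift_Sg)
  have "B # A # \<Gamma> \<turnstile> Tuple (lift 2 A) (rename (upr (\<lambda>n. n + 2)) B) (Var 1) (Var 0) \<Colon>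
      Sg (lift 2 A) (rename (upr (\<lambda>n. n + 2)) B)"
    by (rule ty_Tuple[OF T2, of "Var 1" "Var 0", unfolded iB]) (use cB in \<open>auto intro!: ty_Var_eq simp: numeral_2_eq_2\<close>)
  moreover have "B # A # \<Gamma> \<turnstile> lift 2 (Tuple A B a b) \<Colon> Sg (lift 2 A) (rename (upr (\<lambda>n. n + 2)) B)"
    using weakening[OF t, of "[B, A]" 2] cB by (simp add: lift_Sg)
  ultimately obtain m where P: "A # \<Gamma> \<turnstile> Pi B ?Q \<Colon> Univ m"
    using ty_Pi_ex[OF B ty_Eq[OF T2]] unfolding lift_Sg by blast
  have inst: "inst1 (Pi B ?Q) x = Pi (inst1 B x) (Eq (lift 1 (Sg A B)) (lift 1 (Tuple A B a b))
      (Tuple (lift 1 A) (rename (upr (\<lambda>n. n + 1)) B) (lift 1 x) (Var 0)))" for x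
  proof -
    have "subst (ups (ups (case_nat x Var))) (rename (upr (\<lambda>n. Suc (Suc n))) B) =
      rename (upr Suc) B"
      unfolding rename_eq_subst subst_subst
      by (rule subst_cong) (simp add: upr_def subst_rename split: nat.split)
    moreover have "subst (ups (case_nat x Var)) (lift (Suc (Suc 0)) u) = lift (Suc 0) u" for u
      by (simp add: de_bruijn)
    ultimately show ?thesis
      by (simp add: inst1_def numeral_2_eq_2) (simp add: lift_def)
  qed
  have "inh \<Gamma> (inst1 (Pi B ?Q) a)"
    unfolding inst
  proof -
    let ?\<Gamma> = "inst1 B a # \<Gamma>"
    have c: "\<turnstile> ?\<Gamma> ctx" using T1 typing_wf wf_Cons by blast
    let ?B = "rename (upr (\<lambda>n. n + 1)) B"
    have iB': "inst1 ?B (lift 1 a) = lift 1 (inst1 B a)" by (rule inst1_rename_upr_lift)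
    have Tc: "?\<Gamma> \<turnstile> Sg (lift 1 A) ?B \<Colon> Univ i" using weakening1[OF T c] by (simp add: lift_Sg)
    have bc: "?\<Gamma> \<turnstile> lift 1 b \<Colon> inst1 ?B (lift 1 a)" unfolding iB' by (rule weakening1[OF b c])
    have vc: "?\<Gamma> \<turnstile> Var 0 \<Colon> inst1 ?B (lift 1 a)" unfolding iB' using c by (auto intro!: ty_Var_eq)
    have Tc1: "?\<Gamma> \<turnstile> inst1 ?B (lift 1 a) \<Colon> Univ j" unfolding iB' using weakening1[OF T1 c] by simp
    \<comment> \<open>The fibre is used as a proposition in the context extended by
      \<open>y\<close>: the weakened \<open>b\<close> is compared with that variable.\<close>
    have "inh ?\<Gamma> (Eq (inst1 ?B (lift 1 a)) (lift 1 b) (Var 0))"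
      using pr bc vc unfolding isprop_def iB' by blast
    note E = inh_Tuple_eq_snd[OF Tc weakening1[OF a c] bc Tc1 this, folded lift_Tuple lift_Sg]
    have "?\<Gamma> \<turnstile> Eq (lift 1 (Sg A B)) (lift 1 (Tuple A B a b)) (Tuple (lift 1 A) ?B (lift 1 a) (Var 0)) \<Colon> Univ i"
      unfolding lift_Sg lift_Tuple
      using Tc ty_Tuple[OF Tc weakening1[OF a c] bc] ty_Tuple[OF Tc weakening1[OF a c] vc] by (rule ty_Eq)
    from ty_Pi_ex[OF T1 this] E
    show "inh \<Gamma> (Pi (inst1 B a) (Eq (lift 1 (Sg A B)) (lift 1 (Tuple A B a b)) (Tuple (lift 1 A) ?B (lift 1 a) (Var 0))))"
      using inh_Pi by blast
  qed
  from inh_transport[OF e a P this] obtain h where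
    h: "\<Gamma> \<turnstile> h \<Colon> Pi (inst1 B a') (Eq (lift 1 (Sg A B)) (lift 1 (Tuple A B a b))
      (Tuple (lift 1 A) (rename (upr (\<lambda>n. n + 1)) B) (lift 1 a') (Var 0)))"
    unfolding inst inh_def by blast
  from ty_App[OF h b'] show ?thesis
    using inst1_Tuple_lift[of 0 A B "lift 1 a'" "Var 0" b'] unfolding rename_upr_0 by (simp add: inhI)
qed

subsection \<open>The limit condition\<close>

lemma Pi_inv_body: "\<Gamma> \<turnstile> Pi A B \<Colon> T \<Longrightarrow> \<exists>j. A # \<Gamma> \<turnstile> B \<Colon> Univ j"
  by (erule Pi_inv) blast

section \<open>Relations on small types and the maps that respect them\<close>

definition setoid :: "trm list \<Rightarrow> trm \<Rightarrow> trm \<Rightarrow> bool" where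
  "setoid \<Gamma> D R \<longleftrightarrow> (\<Gamma> \<turnstile> D \<Colon> \<U>) \<and> (\<Gamma> \<turnstile> R \<Colon> D \<rightarrow> D \<rightarrow> \<U>)"

lemma setoid_wf: "setoid \<Gamma> D R \<Longrightarrow> \<turnstile> \<Gamma> ctx"
  unfolding setoid_def using typing_wf by blast

lemma setoid_lift:
  assumes "setoid \<Gamma> D R" "\<turnstile> \<Delta> @ \<Gamma> ctx" "k = length \<Delta>"
  shows "setoid (\<Delta> @ \<Gamma>) (lift k D) (lift k R)"
  using assms weakening[of \<Gamma> D _ \<Delta> k] weakening[of \<Gamma> R _ \<Delta> k] unfolding setoid_def by fastforce

lemma setoid_lift1: "setoid \<Gamma> D R \<Longrightarrow> \<turnstile> A # \<Gamma> ctx \<Longrightarrow> setoid (A # \<Gamma>) (lift 1 D) (lift 1 R)"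
  using setoid_lift[of \<Gamma> D R "[A]" 1] by simp

lemma wf_Cons_setoid: "setoid \<Gamma> D R \<Longrightarrow> \<turnstile> D # \<Gamma> ctx"
  unfolding setoid_def by (blast intro: wf_Cons typing_wf)

lemma wf_Cons_U: "\<turnstile> \<Gamma> ctx \<Longrightarrow> \<turnstile> \<U> # \<Gamma> ctx"
  by (blast intro: wf_Cons ty_Univ)

text \<open>The generic related pair: indices 2 and 1 are elements of \<open>D\<close>, and index 0
  is a proof that the first is related to the second.\<close>

definition rel_ctx :: "trm list \<Rightarrow> trm \<Rightarrow> trm \<Rightarrow> trm list" where
  "rel_ctx \<Gamma> D R = (lift 2 R \<cdot> Var 1 \<cdot> Var 0) # lift 1 D # D # \<Gamma>"

lemma
  assumes b: "setoid \<Gamma> D R"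
  shows wf_rel_ctx: "\<turnstile> rel_ctx \<Gamma> D R ctx"
    and wf_rel_ctx2: "\<turnstile> lift 1 D # D # \<Gamma> ctx"
    and ty_rel_ctx: "lift 1 D # D # \<Gamma> \<turnstile> lift 2 R \<cdot> Var 1 \<cdot> Var 0 \<Colon> \<U>"
proof -
  note c1 = wf_Cons_setoid[OF b]
  show c2: "\<turnstile> lift 1 D # D # \<Gamma> ctx" using wf_Cons_setoid[OF setoid_lift1[OF b c1]] .
  have R2: "lift 1 D # D # \<Gamma> \<turnstile> lift 2 R \<Colon> lift 2 D \<rightarrow> lift 2 D \<rightarrow> \<U>"
    using setoid_lift[OF b, of "[lift 1 D, D]" 2] c2 by (simp add: setoid_def)
  have "lift 1 D # D # \<Gamma> \<turnstile> Var 0 \<Colon> lift 2 D" "lift 1 D # D # \<Gamma> \<turnstile> Var 1 \<Colon> lift 2 D"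
    using c2 by (auto intro!: ty_Var_eq simp: numeral_2_eq_2)
  then show r: "lift 1 D # D # \<Gamma> \<turnstile> lift 2 R \<cdot> Var 1 \<cdot> Var 0 \<Colon> \<U>"
    using ty_Arr_App[OF ty_Arr_App[OF R2]] by blast
  show "\<turnstile> rel_ctx \<Gamma> D R ctx" unfolding rel_ctx_def using c2 r wf_Cons by blast
qed

lemma ty_EqCls:
  assumes b: "setoid \<Gamma> D R" and C: "\<Gamma> \<turnstile> C \<Colon> \<U>" and f: "\<Gamma> \<turnstile> f \<Colon> D \<rightarrow> C"
  shows "\<Gamma> \<turnstile> EqCls D R C f \<Colon> \<U>"
proof -
  note c1 = wf_Cons_setoid[OF b] and c2 = wf_rel_ctx2[OF b]
  have D1: "D # \<Gamma> \<turnstile> lift 1 D \<Colon> \<U>" using setoid_lift1[OF b c1] by (simp add: setoid_def)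
  have v: "lift 1 D # D # \<Gamma> \<turnstile> Var 0 \<Colon> lift 2 D" "lift 1 D # D # \<Gamma> \<turnstile> Var 1 \<Colon> lift 2 D"
    using c2 by (auto intro!: ty_Var_eq simp: numeral_2_eq_2)
  have f2: "lift 1 D # D # \<Gamma> \<turnstile> lift 2 f \<Colon> lift 2 D \<rightarrow> lift 2 C" and C2: "lift 1 D # D # \<Gamma> \<turnstile> lift 2 C \<Colon> \<U>"
    using weakening[OF f, of "[lift 1 D, D]" 2] weakening[OF C, of "[lift 1 D, D]" 2] c2 by auto
  have D0: "\<Gamma> \<turnstile> D \<Colon> \<U>" using b by (simp add: setoid_def)
  from ty_Arr[OF ty_rel_ctx[OF b] ty_Eq[OF C2 ty_Arr_App[OF f2 v(2)] ty_Arr_App[OF f2 v(1)]]]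
  show ?thesis unfolding EqCls_def
    by (rule ty_Pi_impred[OF D0 ty_Pi_impred[OF D1]])
qed

lemma EqCls_App:
  assumes H: "\<Gamma> \<turnstile> H \<Colon> EqCls D R C f" and x: "\<Gamma> \<turnstile> x \<Colon> D" and y: "\<Gamma> \<turnstile> y \<Colon> D"
    and r: "\<Gamma> \<turnstile> r \<Colon> R \<cdot> x \<cdot> y"
  shows "\<Gamma> \<turnstile> H \<cdot> x \<cdot> y \<cdot> r \<Colon> Eq C (f \<cdot> x) (f \<cdot> y)"
proof -
  note [simp] = subst_defs de_bruijn
  note 1 = ty_App[OF H[unfolded EqCls_def] x, simplified]
  note 2 = ty_App[OF 1 y, simplified]
  from ty_Arr_App[OF 2 r] show ?thesis .
qed

lemma EqCls_intro:
  assumes b: "setoid \<Gamma> D R" and C: "\<Gamma> \<turnstile> C \<Colon> \<U>" and f: "\<Gamma> \<turnstile> f \<Colon> D \<rightarrow> C"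
    and e: "inh (rel_ctx \<Gamma> D R) (Eq (lift 3 C) (lift 3 f \<cdot> Var 2) (lift 3 f \<cdot> Var 1))"
  shows "inh \<Gamma> (EqCls D R C f)"
proof -
  note T = ty_EqCls[OF b C f]
  obtain i where T1: "D # \<Gamma> \<turnstile> Pi (lift 1 D) (lift 2 R \<cdot> Var 1 \<cdot> Var 0 \<rightarrow>
      Eq (lift 2 C) (lift 2 f \<cdot> Var 1) (lift 2 f \<cdot> Var 0)) \<Colon> Univ i"
    using T[unfolded EqCls_def] Pi_inv_body by blast
  then obtain j where T2: "lift 1 D # D # \<Gamma> \<turnstile> lift 2 R \<cdot> Var 1 \<cdot> Var 0 \<rightarrow>
      Eq (lift 2 C) (lift 2 f \<cdot> Var 1) (lift 2 f \<cdot> Var 0) \<Colon> Univ j"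
    using Pi_inv_body by blast
  have "lift 1 (Eq (lift 2 C) (lift 2 f \<cdot> Var 1) (lift 2 f \<cdot> Var 0)) =
      Eq (lift 3 C) (lift 3 f \<cdot> Var 2) (lift 3 f \<cdot> Var 1)"
    by (simp add: eval_nat_numeral)
  from inh_Arr[OF T2, unfolded this, OF e[unfolded rel_ctx_def]]
  show ?thesis unfolding EqCls_def
    by (rule inh_Pi[OF T[unfolded EqCls_def] inh_Pi[OF T1]])
qed

text \<open>The arguments of an element of \<open>quot_star D R\<close> as variables: index 2 is the
  target type, index 1 the map, index 0 the proof that it respects \<open>R\<close>. Elements of
  \<open>quot_star D R\<close> are compared in this context.\<close>

definition quot_ctx :: "trm list \<Rightarrow> trm \<Rightarrow> trm \<Rightarrow> trm list" where
  "quot_ctx \<Gamma> D R = EqCls (lift 2 D) (lift 2 R) (Var 1) (Var 0) # (lift 1 D \<rightarrow> Var 0) # \<U> # \<Gamma>"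

lemma
  assumes b: "setoid \<Gamma> D R"
  shows wf_quot_ctx: "\<turnstile> quot_ctx \<Gamma> D R ctx"
    and ty_quot_star: "\<Gamma> \<turnstile> quot_star D R \<Colon> \<U>"
proof -
  note c0 = setoid_wf[OF b]
  note c1 = wf_Cons_U[OF c0]
  have v1: "\<U> # \<Gamma> \<turnstile> Var 0 \<Colon> \<U>" using c1 by (auto intro!: ty_Var_eq)
  have T1: "\<U> # \<Gamma> \<turnstile> lift 1 D \<rightarrow> Var 0 \<Colon> \<U>"
    using setoid_lift1[OF b c1] ty_Arr[OF _ v1] by (auto simp: setoid_def)
  with c1 have c2: "\<turnstile> (lift 1 D \<rightarrow> Var 0) # \<U> # \<Gamma> ctx" by (rule wf_Cons)
  have v2: "(lift 1 D \<rightarrow> Var 0) # \<U> # \<Gamma> \<turnstile> Var 1 \<Colon> \<U>" "(lift 1 D \<rightarrow> Var 0) # \<U> # \<Gamma> \<turnstile> Var 0 \<Colon> lift 2 D \<rightarrow> Var 1"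
    using c2 by (auto intro!: ty_Var_eq simp: numeral_2_eq_2)
  have "setoid ((lift 1 D \<rightarrow> Var 0) # \<U> # \<Gamma>) (lift 2 D) (lift 2 R)"
    using setoid_lift[OF b, of "[lift 1 D \<rightarrow> Var 0, \<U>]" 2] c2 by simp
  from ty_EqCls[OF this v2] have
    T2: "(lift 1 D \<rightarrow> Var 0) # \<U> # \<Gamma> \<turnstile> EqCls (lift 2 D) (lift 2 R) (Var 1) (Var 0) \<Colon> \<U>" .
  show "\<turnstile> quot_ctx \<Gamma> D R ctx" using wf_Cons[OF c2 T2] by (simp add: quot_ctx_def)
  show "\<Gamma> \<turnstile> quot_star D R \<Colon> \<U>" unfolding quot_star_def
    using ty_Pi_impred[OF ty_Univ[OF c0] ty_Pi_impred[OF T1 ty_Arr[OF T2 v2(1)]]] .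
qed

lemma lift_quot_ctx:
  assumes b: "setoid \<Gamma> D R" and t: "\<Gamma> \<turnstile> t \<Colon> A"
  shows "quot_ctx \<Gamma> D R \<turnstile> lift 3 t \<Colon> lift 3 A"
  using weakening[OF t, of "[EqCls (lift 2 D) (lift 2 R) (Var 1) (Var 0), lift 1 D \<rightarrow> Var 0, \<U>]" 3]
    wf_quot_ctx[OF b] by (simp add: quot_ctx_def)

lemma setoid_quot_ctx: "setoid \<Gamma> D R \<Longrightarrow> setoid (quot_ctx \<Gamma> D R) (lift 3 D) (lift 3 R)"
  using lift_quot_ctx[of \<Gamma> D R D \<U>] lift_quot_ctx[of \<Gamma> D R R "D \<rightarrow> D \<rightarrow> \<U>"] by (simp add: setoid_def)

lemma ty_quot_ctx_Var:
  assumes b: "setoid \<Gamma> D R"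
  shows "quot_ctx \<Gamma> D R \<turnstile> Var 2 \<Colon> \<U>" "quot_ctx \<Gamma> D R \<turnstile> Var 1 \<Colon> lift 3 D \<rightarrow> Var 2"
    "quot_ctx \<Gamma> D R \<turnstile> Var 0 \<Colon> EqCls (lift 3 D) (lift 3 R) (Var 2) (Var 1)"
  using wf_quot_ctx[OF b] by (auto intro!: ty_Var_eq simp: quot_ctx_def eval_nat_numeral)

lemma quot_star_App:
  assumes q: "\<Gamma> \<turnstile> q \<Colon> quot_star D R" and C: "\<Gamma> \<turnstile> C \<Colon> \<U>" and f: "\<Gamma> \<turnstile> f \<Colon> D \<rightarrow> C"
    and H: "\<Gamma> \<turnstile> H \<Colon> EqCls D R C f"
  shows "\<Gamma> \<turnstile> rec_star C f H q \<Colon> C"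
proof -
  note [simp] = subst_defs de_bruijn
  note 1 = ty_App[OF q[unfolded quot_star_def] C, simplified]
  note 2 = ty_App[OF 1 f, simplified]
  from ty_Arr_App[OF 2 H] show ?thesis unfolding rec_star_def .
qed

text \<open>One beta step for each of the target type, the map and the proof. The intermediate terms
  are written out because each step substitutes under the abstractions that remain.\<close>

lemma cls_star_conv: "rec_star C f H (cls_star D R d) \<simeq> f \<cdot> d"
proof -
  have 1: "cls_star D R d \<cdot> C \<simeq> Lam (D \<rightarrow> C) (Lam (EqCls (lift 1 D) (lift 1 R) (lift 1 C) (Var 0)) (Var 1 \<cdot> lift 2 d))"
    (is "_ \<simeq> ?t")
    using beta_App[of \<U> "Lam (lift 1 D \<rightarrow> Var 0)
      (Lam (EqCls (lift 2 D) (lift 2 R) (Var 1) (Var 0)) (Var 1 \<cdot> lift 3 d))" C]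
    by (simp add: cls_star_def de_bruijn subst_EqCls subst_Arr)
  have 2: "?t \<cdot> f \<simeq> Lam (EqCls D R C f) (lift 1 f \<cdot> lift 1 d)" (is "_ \<simeq> ?u")
    using beta_App[of "D \<rightarrow> C" "Lam (EqCls (lift 1 D) (lift 1 R) (lift 1 C) (Var 0)) (Var 1 \<cdot> lift 2 d)" f]
    by (simp add: de_bruijn subst_EqCls subst_Arr)
  have 3: "?u \<cdot> H \<simeq> f \<cdot> d" using beta_App[of _ "lift 1 f \<cdot> lift 1 d" H] by simp
  show ?thesis unfolding rec_star_def using 1 2 3
    by (meson conv_trans cong_App conv_refl)
qed

lemma ty_cls_star:
  assumes b: "setoid \<Gamma> D R" and d: "\<Gamma> \<turnstile> d \<Colon> D"
  shows "\<Gamma> \<turnstile> cls_star D R d \<Colon> quot_star D R"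
proof -
  note T = ty_quot_star[OF b, unfolded quot_star_def]
  then obtain i where T1: "\<U> # \<Gamma> \<turnstile> Pi (lift 1 D \<rightarrow> Var 0) (EqCls (lift 2 D) (lift 2 R) (Var 1) (Var 0) \<rightarrow> Var 1) \<Colon> Univ i"
    using Pi_inv_body by blast
  then obtain j where T2: "(lift 1 D \<rightarrow> Var 0) # \<U> # \<Gamma> \<turnstile> EqCls (lift 2 D) (lift 2 R) (Var 1) (Var 0) \<rightarrow> Var 1 \<Colon> Univ j"
    using Pi_inv_body by blast
  have "quot_ctx \<Gamma> D R \<turnstile> Var 1 \<cdot> lift 3 d \<Colon> Var 2"
    using ty_Arr_App[OF ty_quot_ctx_Var(2)[OF b]] lift_quot_ctx[OF b d] by blast
  \<comment> \<open>The type \<open>Var 2\<close> is rewritten as \<open>lift 1 (Var 1)\<close>, the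
    form that the codomain of a non-dependent arrow takes below its binder.\<close>
  then have "EqCls (lift 2 D) (lift 2 R) (Var 1) (Var 0) # (lift 1 D \<rightarrow> Var 0) # \<U> # \<Gamma> \<turnstile> Var 1 \<cdot> lift 3 d \<Colon> lift 1 (Var 1)"
    unfolding quot_ctx_def by (simp add: numeral_2_eq_2)
  from ty_Lam[OF T2[unfolded Arr_def[of "EqCls A B C D" for A B C D]] this] show ?thesis
    unfolding cls_star_def quot_star_def
    using ty_Lam[OF T ty_Lam[OF T1]] Arr_def[of "EqCls A B C D" for A B C D] by simp
qed

section \<open>Formation, uniqueness of proofs and use of the limit condition\<close>

lemma ty_compose:
  assumes f: "\<Gamma> \<turnstile> f \<Colon> A \<rightarrow> B" and g: "\<Gamma> \<turnstile> g \<Colon> D \<rightarrow> A" and D: "\<Gamma> \<turnstile> D \<Colon> Univ i" and B: "\<Gamma> \<turnstile> B \<Colon> \<U>"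
  shows "\<Gamma> \<turnstile> compose D f g \<Colon> D \<rightarrow> B"
proof -
  have c: "\<turnstile> D # \<Gamma> ctx" using D typing_wf wf_Cons by blast
  have v: "D # \<Gamma> \<turnstile> Var 0 \<Colon> lift 1 D" using c by (auto intro!: ty_Var_eq)
  have "D # \<Gamma> \<turnstile> lift 1 f \<cdot> (lift 1 g \<cdot> Var 0) \<Colon> lift 1 B"
    by (rule ty_Arr_App[OF weakening1[OF f c, unfolded lift_defs]
      ty_Arr_App[OF weakening1[OF g c, unfolded lift_defs] v]])
  then show ?thesis unfolding compose_def Arr_def
    by (rule ty_Lam[OF ty_Arr[OF D B, unfolded Arr_def]])
qed

lemma compose_conv: "compose D f g \<cdot> d \<simeq> f \<cdot> (g \<cdot> d)"
  unfolding compose_def using beta_App[of D "lift 1 f \<cdot> (lift 1 g \<cdot> Var 0)" d] by simp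

text \<open>The context of the seven bound variables is built entry by entry, since each entry has
  to be a type over the previous ones before a variable can be looked up. By impredicativity all
  products stay in \<open>\<U>\<close>, although the first two range over \<open>\<U>\<close>
  itself.\<close>

lemma ty_LimQuot:
  assumes b: "setoid \<Gamma> D R" and q: "\<Gamma> \<turnstile> q \<Colon> quot_star D R"
  shows "\<Gamma> \<turnstile> LimQuot D R q \<Colon> \<U>"
proof -
  define A3 where "A3 = lift 2 D \<rightarrow> Var 1"
  define A4 where "A4 = lift 3 D \<rightarrow> Var 1"
  define A5 where "A5 = Var 3 \<rightarrow> Var 2"
  define A6 where "A6 = EqCls (lift 5 D) (lift 5 R) (Var 4) (Var 2)"
  define A7 where "A7 = EqCls (lift 6 D) (lift 6 R) (Var 4) (Var 2)"
  note As = A3_def A4_def A5_def A6_def A7_def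
  note c1 = wf_Cons_U[OF setoid_wf[OF b]]
  note c2 = wf_Cons_U[OF c1]
  have T3: "[\<U>, \<U>] @ \<Gamma> \<turnstile> A3 \<Colon> \<U>" unfolding A3_def
    by (rule ty_Arr) (use setoid_lift[OF b, of "[\<U>, \<U>]" 2] c2 in \<open>auto simp: setoid_def intro!: ty_Var_eq\<close>)
  from wf_Cons[OF _ T3] c2 have c3: "\<turnstile> [A3, \<U>, \<U>] @ \<Gamma> ctx" by simp
  have T4: "[A3, \<U>, \<U>] @ \<Gamma> \<turnstile> A4 \<Colon> \<U>" unfolding A4_def
    by (rule ty_Arr) (use setoid_lift[OF b c3, of 3] c3 in \<open>auto simp: setoid_def intro!: ty_Var_eq\<close>)
  from wf_Cons[OF _ T4] c3 have c4: "\<turnstile> [A4, A3, \<U>, \<U>] @ \<Gamma> ctx" by simp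
  have T5: "[A4, A3, \<U>, \<U>] @ \<Gamma> \<turnstile> A5 \<Colon> \<U>" unfolding A5_def
    by (rule ty_Arr) (use c4 in \<open>auto intro!: ty_Var_eq simp: eval_nat_numeral\<close>)
  from wf_Cons[OF _ T5] c4 have c5: "\<turnstile> [A5, A4, A3, \<U>, \<U>] @ \<Gamma> ctx" by simp
  have T6: "[A5, A4, A3, \<U>, \<U>] @ \<Gamma> \<turnstile> A6 \<Colon> \<U>" unfolding A6_def
    by (rule ty_EqCls[OF setoid_lift[OF b c5]]) (use c5 in \<open>auto intro!: ty_Var_eq simp: As eval_nat_numeral\<close>)
  from wf_Cons[OF _ T6] c5 have c6: "\<turnstile> [A6, A5, A4, A3, \<U>, \<U>] @ \<Gamma> ctx" by simp
  have T7: "[A6, A5, A4, A3, \<U>, \<U>] @ \<Gamma> \<turnstile> A7 \<Colon> \<U>" unfolding A7_def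
    by (rule ty_EqCls[OF setoid_lift[OF b c6]]) (use c6 in \<open>auto intro!: ty_Var_eq simp: As eval_nat_numeral\<close>)
  from wf_Cons[OF _ T7] c6 have c7: "\<turnstile> [A7, A6, A5, A4, A3, \<U>, \<U>] @ \<Gamma> ctx" by simp
  let ?\<Gamma> = "[A7, A6, A5, A4, A3, \<U>, \<U>] @ \<Gamma>"
  have D: "?\<Gamma> \<turnstile> lift 7 D \<Colon> \<U>" using setoid_lift[OF b c7, of 7] by (simp add: setoid_def)
  have q7: "?\<Gamma> \<turnstile> lift 7 q \<Colon> quot_star (lift 7 D) (lift 7 R)" using weakening[OF q c7, of 7] by simp
  have v: "?\<Gamma> \<turnstile> Var 6 \<Colon> \<U>" "?\<Gamma> \<turnstile> Var 5 \<Colon> \<U>" "?\<Gamma> \<turnstile> Var 4 \<Colon> lift 7 D \<rightarrow> Var 6" "?\<Gamma> \<turnstile> Var 3 \<Colon> lift 7 D \<rightarrow> Var 5"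
    "?\<Gamma> \<turnstile> Var 2 \<Colon> Var 6 \<rightarrow> Var 5" "?\<Gamma> \<turnstile> Var 1 \<Colon> EqCls (lift 7 D) (lift 7 R) (Var 6) (Var 4)"
    "?\<Gamma> \<turnstile> Var 0 \<Colon> EqCls (lift 7 D) (lift 7 R) (Var 5) (Var 3)"
    using c7 by (auto intro!: ty_Var_eq simp: As eval_nat_numeral)
  have "?\<Gamma> \<turnstile> Eq (lift 7 D \<rightarrow> Var 5) (compose (lift 7 D) (Var 2) (Var 4)) (Var 3) \<Colon> \<U>"
    by (rule ty_Eq[OF ty_Arr[OF D v(2)] ty_compose[OF v(5) v(3) D v(2)] v(4)])
  moreover have "?\<Gamma> \<turnstile> Eq (Var 5) (Var 2 \<cdot> rec_star (Var 6) (Var 4) (Var 1) (lift 7 q))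
                    (rec_star (Var 5) (Var 3) (Var 0) (lift 7 q)) \<Colon> \<U>"
    by (rule ty_Eq[OF v(2) ty_Arr_App[OF v(5) quot_star_App[OF q7 v(1) v(3) v(6)]] quot_star_App[OF q7 v(2) v(4) v(7)]])
  ultimately have "?\<Gamma> \<turnstile> Eq (lift 7 D \<rightarrow> Var 5) (compose (lift 7 D) (Var 2) (Var 4)) (Var 3) \<rightarrow>
      Eq (Var 5) (Var 2 \<cdot> rec_star (Var 6) (Var 4) (Var 1) (lift 7 q))
        (rec_star (Var 5) (Var 3) (Var 0) (lift 7 q)) \<Colon> \<U>"
    by (rule ty_Arr)
  note T = T3 T4 T5 T6 T7 this
  show ?thesis unfolding LimQuot_def As[symmetric]
    using T[unfolded append.simps] ty_Univ[OF setoid_wf[OF b]] ty_Univ[OF c1] by (intro ty_Pi_impred)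
qed

text \<open>An iterated product that ends in an identity type: function extensionality strips the
  products, and UIP identifies the two equality proofs that remain.\<close>

lemma isprop_LimQuot:
  assumes b: "setoid \<Gamma> D R" and q: "\<Gamma> \<turnstile> q \<Colon> quot_star D R"
  shows "isprop \<Gamma> (LimQuot D R q)"
  using ty_LimQuot[OF assms] unfolding LimQuot_def
  apply (rule isprop_Pi)
  apply (erule isprop_Pi)+
  \<comment> \<open>Only the innermost arrow, whose domain is an identity type, is opened into a
    product; the arrows inside the other domains stay folded.\<close>
  unfolding Arr_def[of "Eq A x y" for A x y]
  apply (erule isprop_Pi)
  apply (simp add: isprop_Eq)
  done

lemma LimQuot_App:
  assumes l: "\<Gamma> \<turnstile> l \<Colon> LimQuot D R q" and X: "\<Gamma> \<turnstile> X \<Colon> \<U>" and Y: "\<Gamma> \<turnstile> Y \<Colon> \<U>"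
    and g: "\<Gamma> \<turnstile> g \<Colon> D \<rightarrow> X" and g': "\<Gamma> \<turnstile> g' \<Colon> D \<rightarrow> Y" and f: "\<Gamma> \<turnstile> f \<Colon> X \<rightarrow> Y"
    and H: "\<Gamma> \<turnstile> H \<Colon> EqCls D R X g" and H': "\<Gamma> \<turnstile> H' \<Colon> EqCls D R Y g'"
    and e: "inh \<Gamma> (Eq (D \<rightarrow> Y) (compose D f g) g')"
  shows "inh \<Gamma> (Eq Y (f \<cdot> rec_star X g H q) (rec_star Y g' H' q))"
proof -
  note [simp] = subst_defs de_bruijn
  note 1 = ty_App[OF l[unfolded LimQuot_def] X, simplified]
  note 2 = ty_App[OF 1 Y, simplified]
  note 3 = ty_App[OF 2 g, simplified]
  note 4 = ty_App[OF 3 g', simplified]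
  note 5 = ty_App[OF 4 f, simplified]
  note 6 = ty_App[OF 5 H, simplified]
  note 7 = ty_App[OF 6 H', simplified]
  from inh_Arr_App[OF inhI[OF 7] e] show ?thesis .
qed

subsection \<open>The quotient and its uniqueness principle\<close>

text \<open>\<open>Split\<close> is applied to the last variable of the context. As this variable is
  itself part of the context, the family, the motive and the branch are all weakened past it, and
  instantiating the weakened motive at the variable restores \<open>P\<close>. A conclusion about a
  variable is the form that function extensionality and abstraction can take up.\<close>

lemma inh_Sg_cases:
  assumes P: "Sg A B # \<Gamma> \<turnstile> P \<Colon> Univ i"
    and h: "inh (B # A # \<Gamma>) (subst (case_nat
      (Tuple (lift 2 A) (rename (upr (\<lambda>n. n + 2)) B) (Var 1) (Var 0)) (\<lambda>n. Var (n + 2))) P)"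
      (is "inh _ ?S")
  shows "inh (Sg A B # \<Gamma>) P"
proof -
  let ?\<Gamma> = "Sg A B # \<Gamma>" and ?A = "lift 1 A" and ?B = "rename (upr Suc) B"
  note c = typing_wf[OF P]
  have Sg1: "lift 1 (Sg A B) = Sg ?A ?B" by (simp add: lift_Sg)
  obtain k where "\<Gamma> \<turnstile> Sg A B \<Colon> Univ k" using c by (rule wf_ctx_Cons_inv)
  then obtain j l where A: "\<Gamma> \<turnstile> A \<Colon> Univ j" and B: "A # \<Gamma> \<turnstile> B \<Colon> Univ l" by (rule Sg_inv)
  have r: "ren Suc \<Gamma> ?\<Gamma>" using c by (simp add: ren_def lift_def rename_rename)
  have A1: "?\<Gamma> \<turnstile> rename Suc A \<Colon> Univ j" using typing_rename[OF A r] by simp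
  note r1 = ren_Cons[OF r A1]
  have B1: "rename Suc A # ?\<Gamma> \<turnstile> rename (upr Suc) B \<Colon> Univ l" using typing_rename[OF B r1] by simp
  note r2 = ren_Cons[OF r1 B1]
  have rA: "rename Suc A = ?A" by (simp add: lift_def)
  obtain b where b: "B # A # \<Gamma> \<turnstile> b \<Colon> ?S" using h by (auto simp: inh_def)
  note b1 = typing_rename[OF b r2, unfolded rename_Split_branch rA]
  have "Sg ?A ?B # ?\<Gamma> \<turnstile> rename (upr Suc) P \<Colon> Univ i"
  proof -
    have "?\<Gamma> \<turnstile> rename Suc (Sg A B) \<Colon> Univ k"
      using typing_rename[OF \<open>\<Gamma> \<turnstile> Sg A B \<Colon> Univ k\<close> r] by simp
    from typing_rename[OF P ren_Cons[OF r this]] show ?thesis by (simp add: lift_def)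
  qed
  moreover have "?\<Gamma> \<turnstile> Var 0 \<Colon> Sg ?A ?B" using c by (auto intro!: ty_Var_eq simp: Sg1[simplified])
  ultimately have "?\<Gamma> \<turnstile> Split (rename (upr Suc) P) (rename (upr (upr Suc)) b) (Var 0) \<Colon>
      inst1 (rename (upr Suc) P) (Var 0)"
    using b1 ty_Split by blast
  then show ?thesis unfolding inst1_rename_upr_Suc by (rule inhI)
qed

lemma ty_proj1:
  assumes T: "\<Gamma> \<turnstile> Sg A B \<Colon> Univ i" and t: "\<Gamma> \<turnstile> t \<Colon> Sg A B"
  shows "\<Gamma> \<turnstile> proj1 A t \<Colon> A"
proof -
  obtain j l where A: "\<Gamma> \<turnstile> A \<Colon> Univ j" and B: "A # \<Gamma> \<turnstile> B \<Colon> Univ l" using T by (rule Sg_inv)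
  have c: "\<turnstile> Sg A B # \<Gamma> ctx" using T typing_wf wf_Cons by blast
  have c2: "\<turnstile> B # A # \<Gamma> ctx" using B typing_wf wf_Cons by blast
  have P: "Sg A B # \<Gamma> \<turnstile> lift 1 A \<Colon> Univ j" using weakening1[OF A c] by simp
  have "B # A # \<Gamma> \<turnstile> Var 1 \<Colon> lift 2 A" using c2 by (auto intro!: ty_Var_eq simp: numeral_2_eq_2)
  moreover have "subst (case_nat u (\<lambda>n. Var (n + 2))) (lift 1 A) = lift 2 A" for u
    by (simp add: de_bruijn)
  ultimately have "\<Gamma> \<turnstile> Split (lift 1 A) (Var 1) t \<Colon> inst1 (lift 1 A) t"
    by (intro ty_Split[OF t P]) simp
  then show ?thesis by (simp add: proj1_def)
qed

lemma proj1_conv: "proj1 A (Tuple A' B x y) \<simeq> x"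
  using beta_Split[of "lift 1 A" "Var 1" A' B x y] by (simp add: proj1_def inst2_def)

section \<open>Elements of the quotient given as pairs\<close>

definition qpair :: "trm \<Rightarrow> trm \<Rightarrow> trm \<Rightarrow> trm \<Rightarrow> trm" where
  "qpair D R q l = Tuple (quot_star D R) (LimQuot (lift 1 D) (lift 1 R) (Var 0)) q l"

lemma subst_qpair: "subst \<sigma> (qpair D R q l) = qpair (subst \<sigma> D) (subst \<sigma> R) (subst \<sigma> q) (subst \<sigma> l)"
  by (simp add: qpair_def subst_defs de_bruijn)

lemma lift_qpair [simp]: "lift k (qpair D R q l) = qpair (lift k D) (lift k R) (lift k q) (lift k l)"
  by (simp add: lift_def rename_eq_subst subst_qpair)

lemma inst1_qpair [simp]:
  "inst1 (qpair D R q l) a = qpair (inst1 D a) (inst1 R a) (inst1 q a) (inst1 l a)"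
  by (simp add: inst1_def subst_qpair)

lemma inst1_LimQuot_family: "inst1 (LimQuot (lift 1 D) (lift 1 R) (Var 0)) q = LimQuot D R q"
  by simp

definition lim_ctx :: "trm list \<Rightarrow> trm \<Rightarrow> trm \<Rightarrow> trm list" where
  "lim_ctx \<Gamma> D R = LimQuot (lift 1 D) (lift 1 R) (Var 0) # quot_star D R # \<Gamma>"

lemma
  assumes b: "setoid \<Gamma> D R"
  shows ty_quot: "\<Gamma> \<turnstile> quot D R \<Colon> \<U>" and wf_lim_ctx: "\<turnstile> lim_ctx \<Gamma> D R ctx"
    and wf_Cons_quot: "\<turnstile> quot D R # \<Gamma> ctx"
proof -
  note T = ty_quot_star[OF b]
  have c: "\<turnstile> quot_star D R # \<Gamma> ctx" by (rule wf_Cons[OF setoid_wf[OF b] T])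
  have v: "quot_star D R # \<Gamma> \<turnstile> Var 0 \<Colon> quot_star (lift 1 D) (lift 1 R)"
    using c by (auto intro!: ty_Var_eq)
  note L = ty_LimQuot[OF setoid_lift1[OF b c] v]
  show Q: "\<Gamma> \<turnstile> quot D R \<Colon> \<U>" using ty_Sg[OF T L] by (simp add: quot_def)
  show "\<turnstile> lim_ctx \<Gamma> D R ctx" unfolding lim_ctx_def by (rule wf_Cons[OF c L])
  show "\<turnstile> quot D R # \<Gamma> ctx" by (rule wf_Cons[OF setoid_wf[OF b] Q])
qed

lemma ty_qpair:
  assumes b: "setoid \<Gamma> D R" and q: "\<Gamma> \<turnstile> q \<Colon> quot_star D R" and l: "\<Gamma> \<turnstile> l \<Colon> LimQuot D R q"
  shows "\<Gamma> \<turnstile> qpair D R q l \<Colon> quot D R"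
  unfolding qpair_def quot_def
  by (rule ty_Tuple[OF ty_quot[OF b, unfolded quot_def] q]) (use l in \<open>simp only: inst1_LimQuot_family\<close>)

lemma inh_qpair_eq:
  assumes b: "setoid \<Gamma> D R" and q: "\<Gamma> \<turnstile> q \<Colon> quot_star D R" and l: "\<Gamma> \<turnstile> l \<Colon> LimQuot D R q"
    and q': "\<Gamma> \<turnstile> q' \<Colon> quot_star D R" and l': "\<Gamma> \<turnstile> l' \<Colon> LimQuot D R q'"
    and e: "inh \<Gamma> (Eq (quot_star D R) q q')"
  shows "inh \<Gamma> (Eq (quot D R) (qpair D R q l) (qpair D R q' l'))"
proof -
  note L = ty_LimQuot[OF b q]
  have c: "\<turnstile> LimQuot D R q # \<Gamma> ctx" by (rule wf_Cons[OF setoid_wf[OF b] L])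
  have "isprop (LimQuot D R q # \<Gamma>) (lift 1 (LimQuot D R q))"
    using isprop_LimQuot[OF setoid_lift1[OF b c] weakening1[OF q c, unfolded lift_defs]] by simp
  from inh_Tuple_eq[OF ty_quot[OF b, unfolded quot_def] q _ _ e, unfolded inst1_LimQuot_family, OF l l' L this]
  show ?thesis unfolding qpair_def quot_def .
qed

text \<open>Function extensionality once for each of the three arguments of an impredicative
  quotient element. Applied to the three variables, \<open>q\<close> is an instance of
  \<open>rec_star\<close>.\<close>

lemma inh_quot_star_eq:
  assumes b: "setoid \<Gamma> D R" and q: "\<Gamma> \<turnstile> q \<Colon> quot_star D R" and q': "\<Gamma> \<turnstile> q' \<Colon> quot_star D R"
    and e: "inh (quot_ctx \<Gamma> D R) (Eq (Var 2) (rec_star (Var 2) (Var 1) (Var 0) (lift 3 q))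
      (rec_star (Var 2) (Var 1) (Var 0) (lift 3 q')))"
  shows "inh \<Gamma> (Eq (quot_star D R) q q')"
proof -
  note c = wf_quot_ctx[OF b, unfolded quot_ctx_def]
  obtain i where i: "(lift 1 D \<rightarrow> Var 0) # \<U> # \<Gamma> \<turnstile> EqCls (lift 2 D) (lift 2 R) (Var 1) (Var 0) \<Colon> Univ i"
    using c by (rule wf_ctx_Cons_inv)
  note c2 = typing_wf[OF i]
  then obtain i2 where "\<U> # \<Gamma> \<turnstile> lift 1 D \<rightarrow> Var 0 \<Colon> Univ i2" by (rule wf_ctx_Cons_inv)
  note c1 = typing_wf[OF this]
  note T = ty_quot_star[OF b, unfolded quot_star_def]
  note Q = q[unfolded quot_star_def] and Q' = q'[unfolded quot_star_def]
  note Q1 = ty_eta_body[OF Q c1] and Q1' = ty_eta_body[OF Q' c1]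
  note Q2 = ty_eta_body[OF Q1 c2] and Q2' = ty_eta_body[OF Q1' c2]
  obtain j1 where T1: "\<U> # \<Gamma> \<turnstile> Pi (lift 1 D \<rightarrow> Var 0) (EqCls (lift 2 D) (lift 2 R) (Var 1) (Var 0) \<rightarrow> Var 1) \<Colon> Univ j1"
    using Pi_inv_body[OF T] by blast
  obtain j2 where T2: "(lift 1 D \<rightarrow> Var 0) # \<U> # \<Gamma> \<turnstile> EqCls (lift 2 D) (lift 2 R) (Var 1) (Var 0) \<rightarrow> Var 1 \<Colon> Univ j2"
    using Pi_inv_body[OF T1] by blast
  have "inh (EqCls (lift 2 D) (lift 2 R) (Var 1) (Var 0) # (lift 1 D \<rightarrow> Var 0) # \<U> # \<Gamma>)
     (Eq (lift 1 (Var 1)) (lift 1 (lift 1 (lift 1 q \<cdot> Var 0) \<cdot> Var 0) \<cdot> Var 0)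
                      (lift 1 (lift 1 (lift 1 q' \<cdot> Var 0) \<cdot> Var 0) \<cdot> Var 0))"
    using e by (simp add: quot_ctx_def rec_star_def eval_nat_numeral)
  from inh_funext[OF T2[unfolded Arr_def[of "EqCls A B C D" for A B C D]] Q2[unfolded Arr_def[of "EqCls A B C D" for A B C D]] Q2'[unfolded Arr_def[of "EqCls A B C D" for A B C D]] this, folded Arr_def]
  have "inh ((lift 1 D \<rightarrow> Var 0) # \<U> # \<Gamma>) (Eq (EqCls (lift 2 D) (lift 2 R) (Var 1) (Var 0) \<rightarrow> Var 1)
     (lift 1 (lift 1 q \<cdot> Var 0) \<cdot> Var 0) (lift 1 (lift 1 q' \<cdot> Var 0) \<cdot> Var 0))" .
  from inh_funext[OF T Q Q' inh_funext[OF T1 Q1 Q1' this]] show ?thesis unfolding quot_star_def .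
qed

section \<open>The class map\<close>

lemma ty_LimCls_App:
  assumes "\<Gamma> \<turnstile> p \<Colon> LimCls D R" "\<Gamma> \<turnstile> d \<Colon> D"
  shows "\<Gamma> \<turnstile> p \<cdot> d \<Colon> LimQuot D R (cls_star D R d)"
  using ty_App[OF assms[unfolded LimCls_def]] by simp

lemma cls_conv: "cls D R p \<cdot> d \<simeq> qpair D R (cls_star D R d) (p \<cdot> d)"
  using beta_App[of D "Tuple (lift 1 (quot_star D R)) (LimQuot (lift 2 D) (lift 2 R) (Var 0))
      (cls_star (lift 1 D) (lift 1 R) (Var 0)) (lift 1 p \<cdot> Var 0)" d]
  by (simp add: cls_def qpair_def subst_defs de_bruijn)

lemma ty_cls:
  assumes b: "setoid \<Gamma> D R" and p: "\<Gamma> \<turnstile> p \<Colon> LimCls D R"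
  shows "\<Gamma> \<turnstile> cls D R p \<Colon> D \<rightarrow> quot D R"
proof -
  note c = wf_Cons_setoid[OF b]
  have D: "\<Gamma> \<turnstile> D \<Colon> \<U>" using b by (simp add: setoid_def)
  have v: "D # \<Gamma> \<turnstile> Var 0 \<Colon> lift 1 D" using c by (auto intro!: ty_Var_eq)
  note b1 = setoid_lift1[OF b c]
  from ty_qpair[OF b1 ty_cls_star[OF b1 v] ty_LimCls_App[OF weakening1[OF p c, unfolded lift_defs] v]]
  have "D # \<Gamma> \<turnstile> Tuple (lift 1 (quot_star D R)) (LimQuot (lift 2 D) (lift 2 R) (Var 0))
      (cls_star (lift 1 D) (lift 1 R) (Var 0)) (lift 1 p \<cdot> Var 0) \<Colon> lift 1 (quot D R)"
    by (simp add: qpair_def numeral_2_eq_2)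
  from ty_Lam[OF ty_Arr[OF D ty_quot[OF b], unfolded Arr_def] this] show ?thesis
    unfolding cls_def Arr_def .
qed

text \<open>Applied to a variable type, map and proof, the two classes compute to the values of that
  map at \<open>x\<close> and \<open>y\<close>, and the proof variable, applied to \<open>r\<close>,
  equates these values.\<close>

lemma inh_cls_star_eq:
  assumes b: "setoid \<Gamma> D R" and x: "\<Gamma> \<turnstile> x \<Colon> D" and y: "\<Gamma> \<turnstile> y \<Colon> D" and r: "\<Gamma> \<turnstile> r \<Colon> R \<cdot> x \<cdot> y"
  shows "inh \<Gamma> (Eq (quot_star D R) (cls_star D R x) (cls_star D R y))"
proof (rule inh_quot_star_eq[OF b ty_cls_star[OF b x] ty_cls_star[OF b y]])
  note b3 = setoid_quot_ctx[OF b] and v = ty_quot_ctx_Var[OF b]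
  note x3 = lift_quot_ctx[OF b x] and y3 = lift_quot_ctx[OF b y]
  from EqCls_App[OF v(3) x3 y3] lift_quot_ctx[OF b r]
  have "inh (quot_ctx \<Gamma> D R) (Eq (Var 2) (Var 1 \<cdot> lift 3 x) (Var 1 \<cdot> lift 3 y))"
    by (auto intro: inhI)
  then show "inh (quot_ctx \<Gamma> D R) (Eq (Var 2) (rec_star (Var 2) (Var 1) (Var 0) (lift 3 (cls_star D R x)))
      (rec_star (Var 2) (Var 1) (Var 0) (lift 3 (cls_star D R y))))"
    unfolding lift_defs
    by (rule inh_conv[OF _ cong_Eq[OF conv_refl conv_sym[OF cls_star_conv] conv_sym[OF cls_star_conv]]
          ty_Eq[OF v(1) quot_star_App[OF ty_cls_star[OF b3 x3] v] quot_star_App[OF ty_cls_star[OF b3 y3] v]]])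
qed

text \<open>The proof components \<open>p \<cdot> x\<close> and \<open>p \<cdot> y\<close> have
  different types, but the limit condition is a proposition, so equality of the underlying
  impredicative classes is enough.\<close>

lemma inh_cls_eq:
  assumes b: "setoid \<Gamma> D R" and p: "\<Gamma> \<turnstile> p \<Colon> LimCls D R"
    and x: "\<Gamma> \<turnstile> x \<Colon> D" and y: "\<Gamma> \<turnstile> y \<Colon> D" and r: "\<Gamma> \<turnstile> r \<Colon> R \<cdot> x \<cdot> y"
  shows "inh \<Gamma> (Eq (quot D R) (cls D R p \<cdot> x) (cls D R p \<cdot> y))"
  using inh_qpair_eq[OF b ty_cls_star[OF b x] ty_LimCls_App[OF p x] ty_cls_star[OF b y] ty_LimCls_App[OF p y]
      inh_cls_star_eq[OF b x y r]]
  by (rule inh_conv[OF _ cong_Eq[OF conv_refl conv_sym[OF cls_conv] conv_sym[OF cls_conv]]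
        ty_Eq[OF ty_quot[OF b] ty_Arr_App[OF ty_cls[OF b p] x] ty_Arr_App[OF ty_cls[OF b p] y]]])

text \<open>Makes \<open>cls\<close> an admissible map in the limit condition when the target type
  is the quotient itself.\<close>

lemma inh_EqCls_cls:
  assumes b: "setoid \<Gamma> D R" and p: "\<Gamma> \<turnstile> p \<Colon> LimCls D R"
  shows "inh \<Gamma> (EqCls D R (quot D R) (cls D R p))"
proof (rule EqCls_intro[OF b ty_quot[OF b] ty_cls[OF b p]])
  note c = wf_rel_ctx[OF b]
  have eq: "rel_ctx \<Gamma> D R = [lift 2 R \<cdot> Var 1 \<cdot> Var 0, lift 1 D, D] @ \<Gamma>" by (simp add: rel_ctx_def)
  have b3: "setoid (rel_ctx \<Gamma> D R) (lift 3 D) (lift 3 R)"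
    unfolding eq by (rule setoid_lift[OF b]) (use c in \<open>simp_all add: rel_ctx_def\<close>)
  have p3: "rel_ctx \<Gamma> D R \<turnstile> lift 3 p \<Colon> LimCls (lift 3 D) (lift 3 R)"
    unfolding eq lift_defs[symmetric] by (rule weakening[OF p]) (use c in \<open>simp_all add: rel_ctx_def\<close>)
  have "rel_ctx \<Gamma> D R \<turnstile> Var 2 \<Colon> lift 3 D" "rel_ctx \<Gamma> D R \<turnstile> Var 1 \<Colon> lift 3 D"
    "rel_ctx \<Gamma> D R \<turnstile> Var 0 \<Colon> lift 3 R \<cdot> Var 2 \<cdot> Var 1"
    using c by (auto intro!: ty_Var_eq simp: rel_ctx_def eval_nat_numeral)
  from inh_cls_eq[OF b3 p3 this]
  show "inh (rel_ctx \<Gamma> D R) (Eq (lift 3 (quot D R)) (lift 3 (cls D R p) \<cdot> Var 2) (lift 3 (cls D R p) \<cdot> Var 1))"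
    by simp
qed

section \<open>The recursor and its computation on classes\<close>

lemma ty_proj1_quot:
  assumes b: "setoid \<Gamma> D R" and t: "\<Gamma> \<turnstile> t \<Colon> quot D R"
  shows "\<Gamma> \<turnstile> proj1 (quot_star D R) t \<Colon> quot_star D R"
  by (rule ty_proj1[OF ty_quot[OF b, unfolded quot_def] t[unfolded quot_def]])

lemma proj1_qpair_conv: "proj1 (quot_star D R) (qpair D R q l) \<simeq> q"
  unfolding qpair_def by (rule proj1_conv)

lemma cong_rec_star: "q \<simeq> q' \<Longrightarrow> rec_star C f H q \<simeq> rec_star C f H q'"
  unfolding rec_star_def by (intro cong_App conv_refl)

lemma rec_q_conv: "rec_q D R C f H \<cdot> t \<simeq> rec_star C f H (proj1 (quot_star D R) t)"
  using beta_App[of "quot D R" "rec_star (lift 1 C) (lift 1 f) (lift 1 H) (proj1 (lift 1 (quot_star D R)) (Var 0))" t]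
  by (simp add: rec_q_def)

lemma ty_rec_q:
  assumes b: "setoid \<Gamma> D R" and C: "\<Gamma> \<turnstile> C \<Colon> \<U>" and f: "\<Gamma> \<turnstile> f \<Colon> D \<rightarrow> C" and H: "\<Gamma> \<turnstile> H \<Colon> EqCls D R C f"
  shows "\<Gamma> \<turnstile> rec_q D R C f H \<Colon> quot D R \<rightarrow> C"
proof -
  note c = wf_Cons_quot[OF b]
  have v: "quot D R # \<Gamma> \<turnstile> Var 0 \<Colon> quot (lift 1 D) (lift 1 R)" using c by (auto intro!: ty_Var_eq)
  note b1 = setoid_lift1[OF b c]
  have "quot D R # \<Gamma> \<turnstile> rec_star (lift 1 C) (lift 1 f) (lift 1 H) (proj1 (lift 1 (quot_star D R)) (Var 0)) \<Colon> lift 1 C"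
    unfolding lift_defs
    using weakening1[OF C c] by (intro quot_star_App[OF ty_proj1_quot[OF b1 v] _ weakening1[OF f c, unfolded lift_defs]
      weakening1[OF H c, unfolded lift_defs]]) simp
  from ty_Lam[OF ty_Arr[OF ty_quot[OF b] C, unfolded Arr_def] this] show ?thesis
    unfolding rec_q_def Arr_def .
qed

text \<open>At each argument this is pure computation: the class is a pair, its projection is the
  impredicative class, and that one applies \<open>f\<close>. Function extensionality turns this
  into an equation of functions, the commuting triangle demanded by
  \<open>LimQuot_App\<close>.\<close>

lemma inh_rec_q_compose_cls:
  assumes b: "setoid \<Gamma> D R" and p: "\<Gamma> \<turnstile> p \<Colon> LimCls D R"
    and C: "\<Gamma> \<turnstile> C \<Colon> \<U>" and f: "\<Gamma> \<turnstile> f \<Colon> D \<rightarrow> C" and H: "\<Gamma> \<turnstile> H \<Colon> EqCls D R C f"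
  shows "inh \<Gamma> (Eq (D \<rightarrow> C) (compose D (rec_q D R C f H) (cls D R p)) f)"
proof -
  have D: "\<Gamma> \<turnstile> D \<Colon> \<U>" using b by (simp add: setoid_def)
  note cmp = ty_compose[OF ty_rec_q[OF b C f H] ty_cls[OF b p] D C]
  note c = wf_Cons_setoid[OF b]
  note cmp1 = ty_eta_body[OF cmp[unfolded Arr_def] c] and f1 = ty_eta_body[OF f[unfolded Arr_def] c]
  have C1: "D # \<Gamma> \<turnstile> lift 1 C \<Colon> \<U>" using weakening1[OF C c] by simp
  have "lift 1 (compose D (rec_q D R C f H) (cls D R p)) \<cdot> Var 0 \<simeq> lift 1 f \<cdot> Var 0"
    unfolding lift_defs
    by (rule conv_trans[OF compose_conv conv_trans[OF cong_App[OF conv_refl cls_conv]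
        conv_trans[OF rec_q_conv conv_trans[OF cong_rec_star[OF proj1_qpair_conv] cls_star_conv]]]])
  from inh_conv[OF inh_refl[OF f1] cong_Eq[OF conv_refl conv_sym[OF this] conv_refl] ty_Eq[OF C1 cmp1 f1]]
  show ?thesis
    unfolding Arr_def
    by (rule inh_funext[OF ty_Arr[OF D C, unfolded Arr_def] cmp[unfolded Arr_def] f[unfolded Arr_def]])
qed

section \<open>Case analysis on elements of the quotient\<close>

lemma inh_quot_cases:
  assumes P: "quot D R # \<Gamma> \<turnstile> P \<Colon> Univ i"
    and h: "inh (lim_ctx \<Gamma> D R)
      (subst (case_nat (qpair (lift 2 D) (lift 2 R) (Var 1) (Var 0)) (\<lambda>n. Var (n + 2))) P)"
  shows "inh (quot D R # \<Gamma>) P"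
proof -
  have "rename (upr (\<lambda>n. n + 2)) (LimQuot (lift 1 D) (lift 1 R) (Var 0)) = LimQuot (lift 1 (lift 2 D)) (lift 1 (lift 2 R)) (Var 0)"
    by (simp add: rename_eq_subst[of _ "LimQuot _ _ _"] subst_LimQuot) (simp add: de_bruijn)
  then have "Tuple (lift 2 (quot_star D R)) (rename (upr (\<lambda>n. n + 2)) (LimQuot (lift 1 D) (lift 1 R) (Var 0))) (Var 1) (Var 0) =
     qpair (lift 2 D) (lift 2 R) (Var 1) (Var 0)"
    by (simp add: qpair_def)
  then show ?thesis using inh_Sg_cases[of "quot_star D R" "LimQuot (lift 1 D) (lift 1 R) (Var 0)" \<Gamma> P] P h
    by (simp only: quot_def lim_ctx_def)
qed

lemma lift_lim_ctx:
  assumes b: "setoid \<Gamma> D R" and t: "\<Gamma> \<turnstile> t \<Colon> A"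
  shows "lim_ctx \<Gamma> D R \<turnstile> lift 2 t \<Colon> lift 2 A"
  using weakening[OF t, of "[LimQuot (lift 1 D) (lift 1 R) (Var 0), quot_star D R]" 2]
    wf_lim_ctx[OF b] by (simp add: lim_ctx_def)

lemma setoid_lim_ctx: "setoid \<Gamma> D R \<Longrightarrow> setoid (lim_ctx \<Gamma> D R) (lift 2 D) (lift 2 R)"
  using lift_lim_ctx[of \<Gamma> D R D \<U>] lift_lim_ctx[of \<Gamma> D R R "D \<rightarrow> D \<rightarrow> \<U>"] by (simp add: setoid_def)

lemma ty_lim_ctx_Var:
  assumes b: "setoid \<Gamma> D R"
  shows "lim_ctx \<Gamma> D R \<turnstile> Var 1 \<Colon> quot_star (lift 2 D) (lift 2 R)"
    "lim_ctx \<Gamma> D R \<turnstile> Var 0 \<Colon> LimQuot (lift 2 D) (lift 2 R) (Var 1)"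
  using wf_lim_ctx[OF b] by (auto intro!: ty_Var_eq simp: lim_ctx_def eval_nat_numeral)

lemma subst_case_lift_1: "subst (case_nat u (\<lambda>n. Var (Suc (Suc n)))) (lift (Suc 0) t) = lift 2 t"
  by (simp add: de_bruijn)

section \<open>From equal projections to uniqueness of the recursor\<close>

lemma inh_qpair_eq_proj1:
  assumes b: "setoid \<Gamma> D R" and q: "\<Gamma> \<turnstile> q \<Colon> quot_star D R" and l: "\<Gamma> \<turnstile> l \<Colon> LimQuot D R q"
    and q': "\<Gamma> \<turnstile> q' \<Colon> quot_star D R" and l': "\<Gamma> \<turnstile> l' \<Colon> LimQuot D R q'"
    and e: "inh \<Gamma> (Eq (quot_star D R) (proj1 (quot_star D R) (qpair D R q l)) q')"
  shows "inh \<Gamma> (Eq (quot D R) (qpair D R q l) (qpair D R q' l'))"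
  by (rule inh_qpair_eq[OF b q l q' l' inh_conv[OF e cong_Eq[OF conv_refl proj1_qpair_conv conv_refl]
    ty_Eq[OF ty_quot_star[OF b] q q']]])

text \<open>The term \<open>z\<close> need not be a pair, so it is eliminated by
  \<open>Split\<close>. The hypothesis \<open>e\<close> mentions \<open>z\<close> and therefore
  enters the motive as the premise of an implication; for a generic pair the projection in it
  computes. The case analysis speaks of a variable, so its result is abstracted into a function,
  applied to \<open>z\<close> and then to \<open>e\<close>.\<close>

lemma inh_eq_qpair:
  assumes b: "setoid \<Gamma> D R" and q: "\<Gamma> \<turnstile> q \<Colon> quot_star D R" and l: "\<Gamma> \<turnstile> l \<Colon> LimQuot D R q"
    and z: "\<Gamma> \<turnstile> z \<Colon> quot D R" and e: "inh \<Gamma> (Eq (quot_star D R) (proj1 (quot_star D R) z) q)"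
  shows "inh \<Gamma> (Eq (quot D R) z (qpair D R q l))"
proof -
  let ?P = "Eq (quot_star (lift 1 D) (lift 1 R)) (proj1 (quot_star (lift 1 D) (lift 1 R)) (Var 0)) (lift 1 q) \<rightarrow>
    Eq (quot (lift 1 D) (lift 1 R)) (Var 0) (qpair (lift 1 D) (lift 1 R) (lift 1 q) (lift 1 l))"
  note c = wf_Cons_quot[OF b]
  note b1 = setoid_lift1[OF b c]
  have v: "quot D R # \<Gamma> \<turnstile> Var 0 \<Colon> quot (lift 1 D) (lift 1 R)" using c by (auto intro!: ty_Var_eq)
  note q1 = weakening1[OF q c, unfolded lift_defs] and l1 = weakening1[OF l c, unfolded lift_defs]
  have P: "quot D R # \<Gamma> \<turnstile> ?P \<Colon> \<U>"
    by (rule ty_Arr[OF ty_Eq[OF ty_quot_star[OF b1] ty_proj1_quot[OF b1 v] q1] ty_Eq[OF ty_quot[OF b1] v ty_qpair[OF b1 q1 l1]]])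
  let ?\<Delta> = "lim_ctx \<Gamma> D R"
  let ?D = "lift 2 D" and ?R = "lift 2 R"
  let ?pr = "qpair ?D ?R (Var 1) (Var 0)"
  let ?E = "Eq (quot_star ?D ?R) (proj1 (quot_star ?D ?R) ?pr) (lift 2 q)"
  note b2 = setoid_lim_ctx[OF b] and q2 = lift_lim_ctx[OF b q, unfolded lift_defs] and l2 = lift_lim_ctx[OF b l, unfolded lift_defs]
  note v2 = ty_lim_ctx_Var[OF b]
  have E: "?\<Delta> \<turnstile> ?E \<Colon> \<U>"
    by (rule ty_Eq[OF ty_quot_star[OF b2] ty_proj1_quot[OF b2 ty_qpair[OF b2 v2]] q2])
  have G: "?\<Delta> \<turnstile> Eq (quot ?D ?R) ?pr (qpair ?D ?R (lift 2 q) (lift 2 l)) \<Colon> \<U>"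
    by (rule ty_Eq[OF ty_quot[OF b2] ty_qpair[OF b2 v2] ty_qpair[OF b2 q2 l2]])
  have "inh (?E # ?\<Delta>) (lift 1 (Eq (quot ?D ?R) ?pr (qpair ?D ?R (lift 2 q) (lift 2 l))))"
  proof -
    have c3: "\<turnstile> ?E # ?\<Delta> ctx" by (rule wf_Cons[OF setoid_wf[OF b2] E])
    note b3 = setoid_lift1[OF b2 c3]
    have "?E # ?\<Delta> \<turnstile> Var 0 \<Colon> lift 1 ?E" using c3 by (auto intro!: ty_Var_eq)
    note e3 = inhI[OF this, unfolded lift_simps lift_defs lift_qpair]
    show ?thesis unfolding lift_simps lift_defs lift_qpair
      by (rule inh_qpair_eq_proj1[OF setoid_lift1[OF b2 c3] weakening1[OF v2(1) c3, unfolded lift_defs lift_simps]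
        weakening1[OF v2(2) c3, unfolded lift_defs lift_simps] weakening1[OF q2 c3, unfolded lift_defs]
        weakening1[OF l2 c3, unfolded lift_defs] e3[unfolded lift_simps]])
  qed
  from inh_Arr[OF ty_Arr[OF E G] this]
  have "inh ?\<Delta> (subst (case_nat ?pr (\<lambda>n. Var (n + 2))) ?P)"
    by (simp add: subst_defs subst_qpair subst_case_lift_1)
  from inh_quot_cases[OF P this] ty_Pi_impred[OF ty_quot[OF b] P] have "inh \<Gamma> (Pi (quot D R) ?P)"
    using inh_Pi by blast
  then have "inh \<Gamma> (inst1 ?P z)" unfolding inh_def using ty_App z by blast
  then show ?thesis using inh_Arr_App e by simp
qed

lemma inh_rec_star_cls:
  assumes b: "setoid \<Gamma> D R" and p: "\<Gamma> \<turnstile> p \<Colon> LimCls D R"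
    and K: "\<Gamma> \<turnstile> K \<Colon> EqCls D R (quot D R) (cls D R p)"
    and q: "\<Gamma> \<turnstile> q \<Colon> quot_star D R" and l: "\<Gamma> \<turnstile> l \<Colon> LimQuot D R q"
  shows "inh \<Gamma> (Eq (quot D R) (rec_star (quot D R) (cls D R p) K q) (qpair D R q l))"
    (is "inh \<Gamma> (Eq _ ?z _)")
proof -
  have z: "\<Gamma> \<turnstile> ?z \<Colon> quot D R" by (rule quot_star_App[OF q ty_quot[OF b] ty_cls[OF b p] K])
  show ?thesis
  proof (rule inh_eq_qpair[OF b q l z], rule inh_quot_star_eq[OF b ty_proj1_quot[OF b z] q])
    note b3 = setoid_quot_ctx[OF b] and v = ty_quot_ctx_Var[OF b]
    note w = lift_quot_ctx[OF b]
    note p3 = w[OF p, unfolded lift_defs] and l3 = w[OF l, unfolded lift_defs] and q3 = w[OF q, unfolded lift_defs]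
      and K3 = w[OF K, unfolded lift_defs] and z3 = w[OF z, unfolded lift_defs]
    note E = LimQuot_App[OF l3 ty_quot[OF b3] v(1) ty_cls[OF b3 p3] v(2) ty_rec_q[OF b3 v] K3 v(3)
      inh_rec_q_compose_cls[OF b3 p3 v]]
    \<comment> \<open>The recursor applied to \<open>?z\<close> computes to \<open>rec_star\<close>
      at the projection of \<open>?z\<close>, so the left-hand side of \<open>E\<close> converts to
      the required one.\<close>
    show "inh (quot_ctx \<Gamma> D R) (Eq (Var 2) (rec_star (Var 2) (Var 1) (Var 0) (lift 3 (proj1 (quot_star D R) ?z)))
      (rec_star (Var 2) (Var 1) (Var 0) (lift 3 q)))"
      unfolding lift_defs
      by (rule inh_conv[OF E cong_Eq[OF conv_refl rec_q_conv conv_refl]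
        ty_Eq[OF v(1) quot_star_App[OF ty_proj1_quot[OF b3 z3] v] quot_star_App[OF q3 v]]])
  qed
qed

lemma inh_eq_rec_star:
  assumes b: "setoid \<Gamma> D R" and p: "\<Gamma> \<turnstile> p \<Colon> LimCls D R"
    and C: "\<Gamma> \<turnstile> C \<Colon> \<U>" and g: "\<Gamma> \<turnstile> g \<Colon> D \<rightarrow> C" and H: "\<Gamma> \<turnstile> H \<Colon> EqCls D R C g"
    and f: "\<Gamma> \<turnstile> f \<Colon> quot D R \<rightarrow> C"
    and e: "inh \<Gamma> (Eq (D \<rightarrow> C) (compose D f (cls D R p)) g)"
    and q: "\<Gamma> \<turnstile> q \<Colon> quot_star D R" and l: "\<Gamma> \<turnstile> l \<Colon> LimQuot D R q"
  shows "inh \<Gamma> (Eq C (f \<cdot> qpair D R q l) (rec_star C g H q))"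
proof -
  \<comment> \<open>Any proof that \<open>cls\<close> respects \<open>R\<close> will do, but both
    equations below must use the same one, since it occurs in the intermediate term
    \<open>rec_star (quot D R) (cls D R p) K q\<close>.\<close>
  obtain K where K: "\<Gamma> \<turnstile> K \<Colon> EqCls D R (quot D R) (cls D R p)"
    using inh_EqCls_cls[OF b p] by (auto simp: inh_def)
  note Q = ty_quot[OF b]
  note z = quot_star_App[OF q Q ty_cls[OF b p] K]
  note pr = ty_qpair[OF b q l]
  note E1 = inh_cong[OF f inh_sym[OF inh_rec_star_cls[OF b p K q l] z Q] pr Q C]
  note E2 = LimQuot_App[OF l Q C ty_cls[OF b p] g f K H e]
  show ?thesis by (rule inh_trans[OF E1 E2 ty_Arr_App[OF f pr] ty_Arr_App[OF f z] C])
qed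

lemma inh_eq_rec_q:
  assumes b: "setoid \<Gamma> D R" and p: "\<Gamma> \<turnstile> p \<Colon> LimCls D R"
    and C: "\<Gamma> \<turnstile> C \<Colon> \<U>" and g: "\<Gamma> \<turnstile> g \<Colon> D \<rightarrow> C" and H: "\<Gamma> \<turnstile> H \<Colon> EqCls D R C g"
    and f: "\<Gamma> \<turnstile> f \<Colon> quot D R \<rightarrow> C"
    and e: "\<Gamma> \<turnstile> e \<Colon> Eq (D \<rightarrow> C) (compose D f (cls D R p)) g"
  shows "inh \<Gamma> (Eq (quot D R \<rightarrow> C) f (rec_q D R C g H))"
proof -
  note c = wf_Cons_quot[OF b]
  note rq = ty_rec_q[OF b C g H]
  note f1 = ty_eta_body[OF f[unfolded Arr_def] c] and rq1 = ty_eta_body[OF rq[unfolded Arr_def] c]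
  have C1: "quot D R # \<Gamma> \<turnstile> lift 1 C \<Colon> \<U>" using weakening1[OF C c] by simp
  let ?P = "Eq (lift 1 C) (lift 1 f \<cdot> Var 0) (lift 1 (rec_q D R C g H) \<cdot> Var 0)"
  let ?pr = "qpair (lift 2 D) (lift 2 R) (Var 1) (Var 0)"
  have "inh (lim_ctx \<Gamma> D R) (subst (case_nat ?pr (\<lambda>n. Var (n + 2))) ?P)"
  proof -
    note b2 = setoid_lim_ctx[OF b] and v = ty_lim_ctx_Var[OF b]
    note w = lift_lim_ctx[OF b]
    have C2: "lim_ctx \<Gamma> D R \<turnstile> lift 2 C \<Colon> \<U>" using w[OF C] by simp
    note g2 = w[OF g, unfolded lift_defs] and f2 = w[OF f, unfolded lift_defs] and H2 = w[OF H, unfolded lift_defs]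
    have e2: "inh (lim_ctx \<Gamma> D R) (Eq (lift 2 D \<rightarrow> lift 2 C) (compose (lift 2 D) (lift 2 f) (cls (lift 2 D) (lift 2 R) (lift 2 p))) (lift 2 g))"
      using w[OF e] by (auto intro: inhI)
    note E = inh_eq_rec_star[OF b2 w[OF p, unfolded lift_defs] C2 g2 H2 f2 e2 v]
    \<comment> \<open>On a pair the recursor projects and then applies the first component, so the
      equation \<open>E\<close> for \<open>rec_star\<close> converts into one for
      \<open>rec_q\<close>.\<close>
    have cv: "rec_star (lift 2 C) (lift 2 g) (lift 2 H) (Var 1) \<simeq> rec_q (lift 2 D) (lift 2 R) (lift 2 C) (lift 2 g) (lift 2 H) \<cdot> ?pr"
      by (rule conv_sym[OF conv_trans[OF rec_q_conv cong_rec_star[OF proj1_qpair_conv]]])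
    note pr = ty_qpair[OF b2 v]
    from inh_conv[OF E cong_Eq[OF conv_refl conv_refl cv] ty_Eq[OF C2 ty_Arr_App[OF f2 pr] ty_Arr_App[OF ty_rec_q[OF b2 C2 g2 H2] pr]]]
    show ?thesis by (simp add: subst_defs subst_case_lift_1)
  qed
  from inh_quot_cases[OF ty_Eq[OF C1 f1 rq1] this]
  show ?thesis unfolding Arr_def
    by (rule inh_funext[OF ty_Arr[OF ty_quot[OF b] C, unfolded Arr_def] f[unfolded Arr_def] rq[unfolded Arr_def]])
qed

theorem theorem5p3p7:
  assumes "\<Gamma> \<turnstile> D \<Colon> \<U>"
    and "\<Gamma> \<turnstile> R \<Colon> D \<rightarrow> D \<rightarrow> \<U>"
    and "\<Gamma> \<turnstile> p \<Colon> LimCls D R"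
    and "\<Gamma> \<turnstile> C \<Colon> \<U>"
    and "\<Gamma> \<turnstile> g \<Colon> D \<rightarrow> C"
    and "\<Gamma> \<turnstile> H \<Colon> EqCls D R C g"
    and "\<Gamma> \<turnstile> f \<Colon> quot D R \<rightarrow> C"
  shows "\<exists>t. \<Gamma> \<turnstile> t \<Colon>
    Eq (D \<rightarrow> C) (compose D f (cls D R p)) g \<rightarrow> Eq (quot D R \<rightarrow> C) f (rec_q D R C g H)"
proof -
  have b: "setoid \<Gamma> D R" using assms(1,2) by (simp add: setoid_def)
  note p = assms(3) and C = assms(4) and g = assms(5) and H = assms(6) and f = assms(7)
  let ?E = "Eq (D \<rightarrow> C) (compose D f (cls D R p)) g"
  have E: "\<Gamma> \<turnstile> ?E \<Colon> \<U>"
    by (rule ty_Eq[OF ty_Arr[OF assms(1) C] ty_compose[OF f ty_cls[OF b p] assms(1) C] g])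
  have G: "\<Gamma> \<turnstile> Eq (quot D R \<rightarrow> C) f (rec_q D R C g H) \<Colon> \<U>"
    by (rule ty_Eq[OF ty_Arr[OF ty_quot[OF b] C] f ty_rec_q[OF b C g H]])
  \<comment> \<open>The assumed equation becomes the last variable of the context and all data are
    weakened past it; abstracting over this variable afterwards gives the term of the
    implication.\<close>
  have c: "\<turnstile> ?E # \<Gamma> ctx" by (rule wf_Cons[OF setoid_wf[OF b] E])
  have C1: "?E # \<Gamma> \<turnstile> lift 1 C \<Colon> \<U>" using weakening1[OF C c] by simp
  have "?E # \<Gamma> \<turnstile> Var 0 \<Colon> Eq (lift 1 D \<rightarrow> lift 1 C)
      (compose (lift 1 D) (lift 1 f) (cls (lift 1 D) (lift 1 R) (lift 1 p))) (lift 1 g)"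
    using c by (auto intro!: ty_Var_eq)
  from inh_eq_rec_q[OF setoid_lift1[OF b c] weakening1[OF p c, unfolded lift_defs] C1
      weakening1[OF g c, unfolded lift_defs] weakening1[OF H c, unfolded lift_defs]
      weakening1[OF f c, unfolded lift_defs] this]
  have "inh (?E # \<Gamma>) (lift 1 (Eq (quot D R \<rightarrow> C) f (rec_q D R C g H)))" by simp
  from inh_Arr[OF ty_Arr[OF E G] this] show ?thesis by (simp add: inh_def)
qed

end
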